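(* The trace preservation problem for parametric timed automata with one parameter is undecidable.
   Context: Clocks are real-valued variables; parameters take nonnegative rational values. An atomic constraint has the form $x\sim p+c$, $x\sim c$, or $p\sim c$ ($\sim\in\{<,\le,=,\ge,>\}$, $c\in\mathbb Z$); a constraint is a conjunction of atomic constraints. A PTA is a tuple $(\Sigma,L,\ell_0,X,P,I,E)$ with finite actions, locations, initial location, clocks, parameters, invariants $I(\ell)$ and edges $(\ell,g,a,R,\ell')$ (guard $g$, action $a$, reset set $R$). For parameter valuation $v$, $v(\mathcal A)$ is the timed automaton obtained by substituting parameter values; configurations $(\ell,w)$ with $w$ satisfying the invariant; steps $(\ell,w)\xrightarrow{d,e}(\ell',w')$ for delay $d\ge0$ and edge $e$ when $w+d$ satisfies the guard and $w'=(w+d)[R\mapsto0]$. A run is a maximal sequence of steps $s_0\xrightarrow{d_0,e_0}s_1\xrightarrow{d_1,e_1}\cdots$ from $(\ell_0,\mathbf 0)$ (finite only if it ends in a configuration with no outgoing step). The untimed trace of the run is the sequence $(\ell_i,a_i)_i$ where $\ell_i$ is the location of $s_i$ and $a_i$ the action of $e_i$; $\mathrm{Traces}(v(\mathcal A))$ is the set of untimed traces of runs. The trace preservation problem: given a PTA $\mathcal A$ and parameter valuation $v$, decide whether there is a parameter valuation $v'\ne v$ with $\mathrm{Traces}(v'(\mathcal A))=\mathrm{Traces}(v(\mathcal A))$. *)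

theory Defs
  imports Complex_Main "HOL-Library.Nat_Bijection" "HOL-Library.FuncSet" "HOL-Library.Extended_Nat"
begin

section \<open>Timed automata\<close>

datatype cmp = Lt | Le | Eq | Ge | Gt

fun cmp_rel :: "cmp \<Rightarrow> real \<Rightarrow> real \<Rightarrow> bool" where
  "cmp_rel Lt a b \<longleftrightarrow> a < b"
| "cmp_rel Le a b \<longleftrightarrow> a \<le> b"
| "cmp_rel Eq a b \<longleftrightarrow> a = b"
| "cmp_rel Ge a b \<longleftrightarrow> a \<ge> b"
| "cmp_rel Gt a b \<longleftrightarrow> a > b"

text \<open>
  The record is shared by timed automata and parametric timed automata, which differ only in the
  type \<open>'c\<close> of atomic constraints. A list of atomic constraints stands for their conjunction.
  An edge \<open>(l, g, a, R, l')\<close> has source \<open>l\<close>, guard \<open>g\<close>, action \<open>a\<close>, reset set \<open>R\<close> and target \<open>l'\<close>.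
\<close>

type_synonym ('a, 'l, 'x, 'c) edge = "'l \<times> 'c list \<times> 'a \<times> 'x set \<times> 'l"

record ('a, 'l, 'x, 'c) automaton =
  actions :: "'a set"
  locs :: "'l set"
  init_loc :: 'l
  clocks :: "'x set"
  invar :: "'l \<Rightarrow> 'c list"
  edges :: "('a, 'l, 'x, 'c) edge set"

text \<open>
  Atomic constraints after substitution of the parameters; \<open>TConst\<close> is what remains of a
  constraint that compares a parameter with an integer.
\<close>

datatype 'x tatom = TClock 'x cmp rat | TConst rat cmp rat

type_synonym ('a, 'l, 'x) ta = "('a, 'l, 'x, 'x tatom) automaton"

fun sat_atom :: "('x \<Rightarrow> real) \<Rightarrow> 'x tatom \<Rightarrow> bool" where
  "sat_atom w (TClock x r q) \<longleftrightarrow> cmp_rel r (w x) (of_rat q)"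
| "sat_atom w (TConst q r q') \<longleftrightarrow> cmp_rel r (of_rat q) (of_rat q')"

definition sat :: "('x \<Rightarrow> real) \<Rightarrow> 'x tatom list \<Rightarrow> bool" where
  "sat w g \<longleftrightarrow> (\<forall>c\<in>set g. sat_atom w c)"

type_synonym ('l, 'x) config = "'l \<times> ('x \<Rightarrow> real)"

definition is_config :: "('a, 'l, 'x) ta \<Rightarrow> ('l, 'x) config \<Rightarrow> bool" where
  "is_config M s \<longleftrightarrow> fst s \<in> locs M \<and> sat (snd s) (invar M (fst s))"

definition delay :: "('x \<Rightarrow> real) \<Rightarrow> real \<Rightarrow> 'x \<Rightarrow> real" where
  "delay w d = (\<lambda>x. w x + d)"

definition reset :: "('x \<Rightarrow> real) \<Rightarrow> 'x set \<Rightarrow> 'x \<Rightarrow> real" where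
  "reset w R = (\<lambda>x. if x \<in> R then 0 else w x)"

text \<open>
  All intermediate points of the delay have to be configurations: as usual, time may elapse in a
  location only while its invariant holds.
\<close>

definition step ::
  "('a, 'l, 'x) ta \<Rightarrow> ('l, 'x) config \<Rightarrow> real \<Rightarrow> ('a, 'l, 'x, 'x tatom) edge \<Rightarrow> ('l, 'x) config \<Rightarrow> bool"
where
  "step M s d e s' \<longleftrightarrow>
     (\<exists>l w g a R l' w'.
        s = (l, w) \<and> s' = (l', w') \<and> e = (l, g, a, R, l') \<and> e \<in> edges M \<and> 0 \<le> d \<and>
        (\<forall>t\<in>{0..d}. is_config M (l, delay w t)) \<and>
        sat (delay w d) g \<and> w' = reset (delay w d) R \<and> is_config M (l', w'))"

text \<open>
  Runs have length \<open>N\<close>, possibly \<open>\<infinity>\<close>: the configurations are \<open>s i\<close> with \<open>i \<le> N\<close>, and the steps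
  \<open>(d i, e i)\<close> with \<open>i < N\<close>; the values of the functions beyond these indices are irrelevant.
\<close>

definition is_run ::
  "('a, 'l, 'x) ta \<Rightarrow> enat \<Rightarrow> (nat \<Rightarrow> ('l, 'x) config) \<Rightarrow> (nat \<Rightarrow> real) \<Rightarrow>
   (nat \<Rightarrow> ('a, 'l, 'x, 'x tatom) edge) \<Rightarrow> bool"
where
  "is_run M N s d e \<longleftrightarrow>
     s 0 = (init_loc M, \<lambda>_. 0) \<and> is_config M (s 0) \<and>
     (\<forall>i. enat i < N \<longrightarrow> step M (s i) (d i) (e i) (s (Suc i))) \<and>
     (\<forall>n. N = enat n \<longrightarrow> \<not> (\<exists>d' e' s'. step M (s n) d' e' s'))"

definition edge_action :: "('a, 'l, 'x, 'c) edge \<Rightarrow> 'a" where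
  "edge_action e = (case e of (l, g, a, R, l') \<Rightarrow> a)"

text \<open>
  A finite or infinite sequence over \<open>'l \<times> 'a\<close> is a function on \<^typ>\<open>nat\<close> that is \<^const>\<open>None\<close>
  from its length on.
\<close>

definition trace_of ::
  "enat \<Rightarrow> (nat \<Rightarrow> ('l, 'x) config) \<Rightarrow> (nat \<Rightarrow> ('a, 'l, 'x, 'c) edge) \<Rightarrow> nat \<Rightarrow> ('l \<times> 'a) option"
where
  "trace_of N s e = (\<lambda>i. if enat i < N then Some (fst (s i), edge_action (e i)) else None)"

definition Traces :: "('a, 'l, 'x) ta \<Rightarrow> (nat \<Rightarrow> ('l \<times> 'a) option) set" where
  "Traces M = {trace_of N s e | N s d e. is_run M N s d e}"


section \<open>Parametric timed automata\<close>

text \<open>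
  The atomic constraints are \<open>x \<sim> p + c\<close>, \<open>x \<sim> c\<close> and \<open>p \<sim> c\<close>.
\<close>

datatype ('x, 'p) patom =
    ClockParam 'x cmp 'p int
  | ClockConst 'x cmp int
  | ParamConst 'p cmp int

record ('a, 'l, 'x, 'p) pta = "('a, 'l, 'x, ('x, 'p) patom) automaton" +
  params :: "'p set"

fun atom_over :: "'x set \<Rightarrow> 'p set \<Rightarrow> ('x, 'p) patom \<Rightarrow> bool" where
  "atom_over X P (ClockParam x r p c) \<longleftrightarrow> x \<in> X \<and> p \<in> P"
| "atom_over X P (ClockConst x r c) \<longleftrightarrow> x \<in> X"
| "atom_over X P (ParamConst p r c) \<longleftrightarrow> p \<in> P"

text \<open>
  The invariant is a total HOL function; fixing it outside the set of locations makes an automaton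
  determined by its finite description.
\<close>

definition is_pta :: "('a, 'l, 'x, 'p) pta \<Rightarrow> bool" where
  "is_pta A \<longleftrightarrow>
     finite (actions A) \<and> finite (locs A) \<and> init_loc A \<in> locs A \<and>
     finite (clocks A) \<and> finite (params A) \<and> finite (edges A) \<and>
     (\<forall>l\<in>locs A. \<forall>c\<in>set (invar A l). atom_over (clocks A) (params A) c) \<and>
     (\<forall>l. l \<notin> locs A \<longrightarrow> invar A l = []) \<and>
     (\<forall>(l, g, a, R, l')\<in>edges A.
        l \<in> locs A \<and> l' \<in> locs A \<and> a \<in> actions A \<and> R \<subseteq> clocks A \<and>
        (\<forall>c\<in>set g. atom_over (clocks A) (params A) c))"

text \<open>
  Valuations are extensional functions, so that two of them differ iff they differ on a parameter.
\<close>

definition valuations :: "('a, 'l, 'x, 'p) pta \<Rightarrow> ('p \<Rightarrow> rat) set" where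
  "valuations A = params A \<rightarrow>\<^sub>E {q. 0 \<le> q}"

fun subst_atom :: "('p \<Rightarrow> rat) \<Rightarrow> ('x, 'p) patom \<Rightarrow> 'x tatom" where
  "subst_atom v (ClockParam x r p c) = TClock x r (v p + of_int c)"
| "subst_atom v (ClockConst x r c) = TClock x r (of_int c)"
| "subst_atom v (ParamConst p r c) = TConst (v p) r (of_int c)"

definition instantiate :: "('p \<Rightarrow> rat) \<Rightarrow> ('a, 'l, 'x, 'p) pta \<Rightarrow> ('a, 'l, 'x) ta" where
  "instantiate v A =
     \<lparr>actions = actions A, locs = locs A, init_loc = init_loc A, clocks = clocks A,
      invar = (\<lambda>l. map (subst_atom v) (invar A l)),
      edges = (\<lambda>(l, g, a, R, l'). (l, map (subst_atom v) g, a, R, l')) ` edges A\<rparr>"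

definition trace_preservation :: "('a, 'l, 'x, 'p) pta \<Rightarrow> ('p \<Rightarrow> rat) \<Rightarrow> bool" where
  "trace_preservation A v \<longleftrightarrow>
     (\<exists>v'\<in>valuations A. v' \<noteq> v \<and> Traces (instantiate v' A) = Traces (instantiate v A))"


section \<open>Decidability\<close>

text \<open>
  Partial recursive functions. Terms carry no arity: \<open>Zero\<close> is the zero function of every arity,
  \<open>Proj i\<close> the (0-based) projection of every arity exceeding \<open>i\<close>. The recursion and minimisation
  variable is the first argument; in the step function of a primitive recursion it is preceded by
  the previous value.
\<close>

datatype recf = Zero | Succ | Proj nat | Comp recf "recf list" | PrimRec recf recf | Mu recf

inductive reval :: "recf \<Rightarrow> nat list \<Rightarrow> nat \<Rightarrow> bool" where
  zero: "reval Zero xs 0"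
| succ: "reval Succ [x] (Suc x)"
| proj: "i < length xs \<Longrightarrow> reval (Proj i) xs (xs ! i)"
| comp: "list_all2 (\<lambda>g y. reval g xs y) gs ys \<Longrightarrow> reval f ys z \<Longrightarrow> reval (Comp f gs) xs z"
| prim0: "reval f xs y \<Longrightarrow> reval (PrimRec f g) (0 # xs) y"
| primSuc: "reval (PrimRec f g) (n # xs) y \<Longrightarrow> reval g (y # n # xs) z \<Longrightarrow>
    reval (PrimRec f g) (Suc n # xs) z"
| mu: "reval f (n # xs) 0 \<Longrightarrow> (\<forall>m<n. \<exists>y>0. reval f (m # xs) y) \<Longrightarrow> reval (Mu f) xs n"

inductive_cases reval_elims:
  "reval Zero xs y" "reval Succ xs y" "reval (Proj i) xs y" "reval (Comp f gs) xs y"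
  "reval (PrimRec f g) (0 # xs) y" "reval (PrimRec f g) (Suc n # xs) y" "reval (Mu f) xs y"

lemma reval_functional: "reval f xs y \<Longrightarrow> reval f xs z \<Longrightarrow> y = z"
proof (induction arbitrary: z rule: reval.induct)
  case (comp xs gs ys f z z')
  from comp.prems obtain ys' where ys': "list_all2 (\<lambda>g y. reval g xs y) gs ys'" "reval f ys' z'"
    by (rule reval_elims(4))
  with comp.IH(1) have "ys = ys'"
    unfolding list_all2_conv_all_nth by (intro nth_equalityI) auto
  then show ?case using comp.IH(2) ys'(2) by blast
next
  case (prim0 f xs y g)
  from prim0.prems have "reval f xs z" by (rule reval_elims(5))
  then show ?case by (rule prim0.IH)
next
  case (primSuc f g n xs y z z')
  from primSuc.prems obtain y' where "reval (PrimRec f g) (n # xs) y'" "reval g (y' # n # xs) z'"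
    by (rule reval_elims(6))
  with primSuc.IH show ?case by blast
next
  case (mu f n xs)
  from mu.prems have z: "reval f (z # xs) 0" "\<forall>m<z. \<exists>y>0. reval f (m # xs) y"
    by (auto elim: reval_elims(7))
  have "\<not> z < n" using mu.IH(2) z(1) by blast
  moreover have "\<not> n < z" using mu.IH(1) z(2) by blast
  ultimately show ?case by simp
qed (blast elim: reval_elims(1-3))+

text \<open>
  A decision problem consists of a set of instances, a coding of instances by natural numbers and
  the property to be decided. A decision procedure has to terminate with the correct answer on the
  codes of instances; nothing is required on other inputs.
\<close>

definition decidable_problem :: "('i \<Rightarrow> nat) \<Rightarrow> 'i set \<Rightarrow> ('i \<Rightarrow> bool) \<Rightarrow> bool" where
  "decidable_problem code Inst Q \<longleftrightarrow>
     (\<exists>f. \<forall>i\<in>Inst. reval f [code i] (if Q i then 1 else 0))"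


section \<open>Coding of parametric timed automata\<close>

text \<open>
  As inputs of a decision procedure, automata have natural numbers as names of their actions,
  locations, clocks and parameters. The codings are built from the explicit bijections
  \<^const>\<open>prod_encode\<close>, \<^const>\<open>int_encode\<close>, \<^const>\<open>list_encode\<close> and \<^const>\<open>set_encode\<close> (the latter for
  finite sets).
\<close>

fun cmp_code :: "cmp \<Rightarrow> nat" where
  "cmp_code Lt = 0"
| "cmp_code Le = 1"
| "cmp_code Eq = 2"
| "cmp_code Ge = 3"
| "cmp_code Gt = 4"

fun patom_code :: "(nat, nat) patom \<Rightarrow> nat" where
  "patom_code (ClockParam x r p c) =
     prod_encode (0, prod_encode (x, prod_encode (cmp_code r, prod_encode (p, int_encode c))))"
| "patom_code (ClockConst x r c) =
     prod_encode (1, prod_encode (x, prod_encode (cmp_code r, int_encode c)))"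
| "patom_code (ParamConst p r c) =
     prod_encode (2, prod_encode (p, prod_encode (cmp_code r, int_encode c)))"

definition constraint_code :: "(nat, nat) patom list \<Rightarrow> nat" where
  "constraint_code g = list_encode (map patom_code g)"

definition edge_code :: "(nat, nat, nat, (nat, nat) patom) edge \<Rightarrow> nat" where
  "edge_code e = (case e of (l, g, a, R, l') \<Rightarrow>
     list_encode [l, constraint_code g, a, set_encode R, l'])"

definition pta_code :: "(nat, nat, nat, nat) pta \<Rightarrow> nat" where
  "pta_code A = list_encode
     [set_encode (actions A), set_encode (locs A), init_loc A, set_encode (clocks A),
      set_encode (params A),
      set_encode ((\<lambda>l. prod_encode (l, constraint_code (invar A l))) ` locs A),
      set_encode (edge_code ` edges A)]"

definition rat_code :: "rat \<Rightarrow> nat" where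
  "rat_code q = (case quotient_of q of (n, d) \<Rightarrow> prod_encode (int_encode n, int_encode d))"

definition valuation_code :: "nat set \<Rightarrow> (nat \<Rightarrow> rat) \<Rightarrow> nat" where
  "valuation_code P v = set_encode ((\<lambda>p. prod_encode (p, rat_code (v p))) ` P)"

definition instance_code :: "(nat, nat, nat, nat) pta \<times> (nat \<Rightarrow> rat) \<Rightarrow> nat" where
  "instance_code i = (case i of (A, v) \<Rightarrow> prod_encode (pta_code A, valuation_code (params A) v))"

definition one_parameter_instances :: "((nat, nat, nat, nat) pta \<times> (nat \<Rightarrow> rat)) set" where
  "one_parameter_instances = {(A, v). is_pta A \<and> card (params A) = 1 \<and> v \<in> valuations A}"

subsection \<open>Distinct instances have distinct codes\<close>

lemma cmp_code_inject: "cmp_code r = cmp_code r' \<longleftrightarrow> r = r'"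
  by (cases r; cases r') auto

lemma inj_patom_code: "inj patom_code"
proof (rule injI)
  fix a b assume "patom_code a = patom_code b"
  then show "a = b"
    by (cases a; cases b) (auto simp: cmp_code_inject int_encode_eq)
qed

lemma constraint_code_inject: "constraint_code g = constraint_code h \<longleftrightarrow> g = h"
  unfolding constraint_code_def by (simp add: list_encode_eq inj_patom_code inj_map_eq_map)

lemma rat_code_inject: "rat_code q = rat_code q' \<longleftrightarrow> q = q'"
  by (auto simp: rat_code_def int_encode_eq split: prod.splits intro: quotient_of_inject)

lemma graph_image_eqD:
  assumes "(\<lambda>x. prod_encode (x, f x)) ` S = (\<lambda>x. prod_encode (x, g x)) ` S" "x \<in> S"
  shows "f x = g x"
proof -
  have "prod_encode (x, f x) \<in> (\<lambda>x. prod_encode (x, g x)) ` S" using assms by blast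
  then show ?thesis by auto
qed

lemma edge_code_inj_on:
  assumes "\<And>l g a R l'. (l, g, a, R, l') \<in> E \<Longrightarrow> finite R"
  shows "inj_on edge_code E"
proof (rule inj_onI)
  fix e e' assume *: "e \<in> E" "e' \<in> E" "edge_code e = edge_code e'"
  obtain l g a R l' where e: "e = (l, g, a, R, l')" by (cases e)
  obtain m h b S m' where e': "e' = (m, h, b, S, m')" by (cases e')
  have "finite R" "finite S" using * assms e e' by blast+
  then show "e = e'"
    using *(3) unfolding e e' edge_code_def
    by (simp add: constraint_code_inject set_encode_eq list_encode_eq)
qed

lemma inj_on_instance_code: "inj_on instance_code one_parameter_instances"
proof (rule inj_onI)
  fix i j assume ij: "i \<in> one_parameter_instances" "j \<in> one_parameter_instances"
    and eq: "instance_code i = instance_code j"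
  obtain A v where i: "i = (A, v)" by (cases i)
  obtain B u where j: "j = (B, u)" by (cases j)
  from ij have A: "is_pta A" "v \<in> valuations A" and B: "is_pta B" "u \<in> valuations B"
    unfolding i j one_parameter_instances_def by auto
  have fin: "finite (actions A)" "finite (locs A)" "finite (clocks A)" "finite (params A)"
      "finite (edges A)" "finite (actions B)" "finite (locs B)" "finite (clocks B)"
      "finite (params B)" "finite (edges B)"
    using A B unfolding is_pta_def by auto
  have finR: "finite R" if "(l, g, a, R, l') \<in> edges A \<union> edges B" for l g a R l'
  proof -
    have "R \<subseteq> clocks A \<or> R \<subseteq> clocks B" using that A B unfolding is_pta_def by fastforce
    then show ?thesis using fin finite_subset by blast
  qed
  have codes: "pta_code A = pta_code B" "valuation_code (params A) v = valuation_code (params B) u"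
    using eq unfolding i j instance_code_def by simp_all
  note eqs = codes(1)[unfolded pta_code_def list_encode_eq list.inject]
  note set_eqD = set_encode_eq[THEN iffD1, rotated 2]
  have "actions A = actions B" by (rule set_eqD) (use eqs fin in blast)+
  moreover have "locs A = locs B" by (rule set_eqD) (use eqs fin in blast)+
  moreover have "init_loc A = init_loc B" using eqs by blast
  moreover have "clocks A = clocks B" by (rule set_eqD) (use eqs fin in blast)+
  moreover have "params A = params B" by (rule set_eqD) (use eqs fin in blast)+
  ultimately have same: "actions A = actions B" "locs A = locs B" "init_loc A = init_loc B"
      "clocks A = clocks B" "params A = params B" .
  have inv: "(\<lambda>l. prod_encode (l, constraint_code (invar A l))) ` locs A =
      (\<lambda>l. prod_encode (l, constraint_code (invar B l))) ` locs B"
    by (rule set_eqD) (use eqs fin in blast)+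
  have edg: "edge_code ` edges A = edge_code ` edges B"
    by (rule set_eqD) (use eqs fin in blast)+
  have val: "(\<lambda>p. prod_encode (p, rat_code (v p))) ` params A =
      (\<lambda>p. prod_encode (p, rat_code (u p))) ` params A"
    by (rule set_eqD)
      (use codes(2)[unfolded valuation_code_def, folded same(5)] fin in blast)+
  have "inj_on edge_code (edges A \<union> edges B)"
    by (rule edge_code_inj_on) (rule finR)
  then have edges: "edges A = edges B"
    using edg inj_on_image_eq_iff[of edge_code "edges A \<union> edges B" "edges A" "edges B"] by simp
  have invar: "invar A = invar B"
  proof
    fix l show "invar A l = invar B l"
    proof (cases "l \<in> locs A")
      case True
      have "constraint_code (invar A l) = constraint_code (invar B l)"
        by (rule graph_image_eqD[OF _ True]) (use inv same(2) in simp)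
      then show ?thesis by (simp only: constraint_code_inject)
    next
      case False
      then have "l \<notin> locs B" using same(2) by simp
      have "\<forall>l. l \<notin> locs A \<longrightarrow> invar A l = []" "\<forall>l. l \<notin> locs B \<longrightarrow> invar B l = []"
        using A(1) B(1) unfolding is_pta_def by blast+
      with False \<open>l \<notin> locs B\<close> show ?thesis by simp
    qed
  qed
  have "A = B" by (rule pta.equality) (simp_all add: same edges invar)
  moreover have "v = u"
  proof
    fix p show "v p = u p"
    proof (cases "p \<in> params A")
      case True
      have "rat_code (v p) = rat_code (u p)" by (rule graph_image_eqD[OF val True])
      then show ?thesis by (simp only: rat_code_inject)
    next
      case False
      then have "p \<notin> params B" using same(5) by simp
      have "v p = undefined" "u p = undefined"
        using A(2) B(2) False \<open>p \<notin> params B\<close> unfolding valuations_def by (blast intro: PiE_arb)+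
      then show ?thesis by simp
    qed
  qed
  ultimately show "i = j" by (simp only: i j)
qed

end

theory Submission
  imports Defs
begin

text \<open>
  Suppose that \<open>f\<close> decides the problem. A register program is simulated by an automaton with one
  parameter \<open>p\<close> in which time is divided into cycles of length \<open>p\<close>, and a register holding \<open>n\<close> is a
  clock with value \<open>n\<close> at the beginning of each cycle. A special location is entered if a register
  comes close to \<open>p\<close>, or if the program ends with a nonzero output; no other behaviour is
  visible in the traces, because from every other location the automaton can also cheat by letting a
  cycle last longer than \<open>p\<close>, and may then move around freely. For \<open>p = 0\<close> the special location is
  unreachable. So for a program that terminates, the traces at \<open>p = 0\<close> are preserved by some \<open>p > 0\<close>
  iff its output is \<open>0\<close>.

  The program to be simulated computes from its input \<open>c\<close> the code of an instance and applies \<open>f\<close> to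
  it. The automaton loads the input by a single edge, with guard \<open>x = c\<close>, and its sets of locations
  and clocks are padded to \<open>{..<c}\<close>; hence the code of the automaton is a simple function of \<open>c\<close> and
  the code \<open>K\<close> of the set of all other edges, which do not depend on \<open>c\<close>. With \<open>c = K\<close> the
  program applies \<open>f\<close> to its own automaton, and outputs the wrong answer.
\<close>

subsection \<open>Computable functions\<close>

definition computable :: "nat \<Rightarrow> (nat list \<Rightarrow> nat) \<Rightarrow> bool" where
  "computable k h \<longleftrightarrow> (\<exists>f. \<forall>xs. length xs = k \<longrightarrow> reval f xs (h xs))"

lemma reval_Comp1: "reval g xs a \<Longrightarrow> reval f [a] z \<Longrightarrow> reval (Comp f [g]) xs z"
  by (rule reval.comp[where ys = "[a]"]) auto

lemma reval_Comp2:
  "reval g xs a \<Longrightarrow> reval h xs b \<Longrightarrow> reval f [a, b] z \<Longrightarrow> reval (Comp f [g, h]) xs z"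
  by (rule reval.comp[where ys = "[a, b]"]) auto

lemma reval_const: "\<exists>f. \<forall>xs. reval f xs n"
proof (induction n)
  case 0
  show ?case using reval.zero by blast
next
  case (Suc n)
  then obtain f where "\<And>xs. reval f xs n" by blast
  then have "reval (Comp Succ [f]) xs (Suc n)" for xs by (rule reval_Comp1[OF _ reval.succ])
  then show ?case by blast
qed

lemma computable_const: "computable k (\<lambda>_. n)"
  using reval_const unfolding computable_def by blast

lemma computable_nth: "i < k \<Longrightarrow> computable k (\<lambda>xs. xs ! i)"
  unfolding computable_def using reval.proj by blast

lemma computable_compose:
  assumes "computable 1 (\<lambda>xs. u (xs ! 0))" "computable k h"
  shows "computable k (\<lambda>xs. u (h xs))"
proof -
  from assms(1) obtain f where f: "\<And>xs. length xs = 1 \<Longrightarrow> reval f xs (u (xs ! 0))"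
    unfolding computable_def by blast
  from assms(2) obtain g where g: "\<And>xs. length xs = k \<Longrightarrow> reval g xs (h xs)"
    unfolding computable_def by blast
  have "reval (Comp f [g]) xs (u (h xs))" if "length xs = k" for xs
    using f[of "[h xs]"] by (intro reval_Comp1[OF g[OF that]]) simp
  then show ?thesis unfolding computable_def by blast
qed

lemma computable_Suc:
  assumes "computable k h"
  shows "computable k (\<lambda>xs. Suc (h xs))"
proof (rule computable_compose[of Suc, OF _ assms])
  have "reval Succ xs (Suc (xs ! 0))" if "length xs = 1" for xs
    using that reval.succ by (cases xs) auto
  then show "computable 1 (\<lambda>xs. Suc (xs ! 0))" unfolding computable_def by blast
qed

lemma reval_add: "reval (PrimRec (Proj 0) (Comp Succ [Proj 0])) [m, n] (m + n)"
proof (induction m)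
  case 0
  show ?case using reval.prim0[OF reval.proj[of 0 "[n]"]] by simp
next
  case (Suc m)
  have "reval (Comp Succ [Proj 0]) [m + n, m, n] (Suc (m + n))"
    using reval.proj[of 0 "[m + n, m, n]"] by (intro reval_Comp1[OF _ reval.succ]) simp
  with Suc show ?case by (auto intro: reval.primSuc)
qed

lemma computable_add:
  assumes "computable k g" "computable k h"
  shows "computable k (\<lambda>xs. g xs + h xs)"
proof -
  obtain f where f: "\<And>m n. reval f [m, n] (m + n)" using reval_add by blast
  obtain p where p: "\<And>xs. length xs = k \<Longrightarrow> reval p xs (g xs)"
    using assms(1) unfolding computable_def by blast
  obtain q where q: "\<And>xs. length xs = k \<Longrightarrow> reval q xs (h xs)"
    using assms(2) unfolding computable_def by blast
  have "reval (Comp f [p, q]) xs (g xs + h xs)" if "length xs = k" for xs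
    by (rule reval_Comp2[OF p[OF that] q[OF that] f])
  then show ?thesis unfolding computable_def by blast
qed

text \<open>Recursion without parameters suffices: apart from addition, every function needed is a
  unary recursion to which \<open>computable_compose\<close> supplies the argument.\<close>

lemma computable_recursion:
  assumes step: "computable 2 (\<lambda>xs. s (xs ! 0) (xs ! 1))"
    and "u 0 = k" "\<And>n. u (Suc n) = s (u n) n"
  shows "computable 1 (\<lambda>xs. u (xs ! 0))"
proof -
  obtain f where f: "\<And>xs. reval f xs k" using reval_const by blast
  obtain g where g: "\<And>xs. length xs = 2 \<Longrightarrow> reval g xs (s (xs ! 0) (xs ! 1))"
    using step unfolding computable_def by blast
  have "reval (PrimRec f g) [n] (u n)" for n
  proof (induction n)
    case 0
    show ?case using f assms(2) by (auto intro: reval.prim0)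
  next
    case (Suc n)
    with g[of "[u n, n]"] show ?case using assms(3) by (auto intro: reval.primSuc)
  qed
  then have "reval (PrimRec f g) xs (u (xs ! 0))" if "length xs = 1" for xs
    using that by (cases xs) auto
  then show ?thesis unfolding computable_def by blast
qed

lemma computable_power2:
  assumes "computable k h"
  shows "computable k (\<lambda>xs. 2 ^ h xs)"
proof (rule computable_compose[of "\<lambda>n. 2 ^ n", OF _ assms])
  show "computable 1 (\<lambda>xs. 2 ^ (xs ! 0))"
    by (rule computable_recursion[where s = "\<lambda>y n. y + y" and k = 1])
      (auto intro!: computable_add computable_nth)
qed

lemma computable_prod_encode:
  assumes "computable k g" "computable k h"
  shows "computable k (\<lambda>xs. prod_encode (g xs, h xs))"
proof -
  have "computable 1 (\<lambda>xs. triangle (xs ! 0))"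
    by (rule computable_recursion[where s = "\<lambda>y n. y + Suc n" and k = 0])
      (auto intro!: computable_add computable_Suc computable_nth)
  then have "computable k (\<lambda>xs. triangle (g xs + h xs))"
    by (rule computable_compose) (intro computable_add assms)
  then show ?thesis
    unfolding prod_encode_def prod.case by (rule computable_add[OF _ assms(1)])
qed

lemma computable_sum:
  assumes "computable 1 (\<lambda>xs. u (xs ! 0))" "computable k h"
  shows "computable k (\<lambda>xs. \<Sum>i<h xs. u i)"
proof (rule computable_compose[of "\<lambda>n. \<Sum>i<n. u i", OF _ assms(2)])
  show "computable 1 (\<lambda>xs. \<Sum>i<xs ! 0. u i)"
    by (rule computable_recursion[where s = "\<lambda>y n. y + u n" and k = 0])
      (auto intro!: computable_add computable_compose[OF assms(1)] intro: computable_nth)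
qed


subsection \<open>Register programs\<close>

datatype com = SKIP | INC nat | DEC nat | SEQ com com | WHILE nat com

text \<open>Only terminating executions are derivable, which suffices since a decision procedure
  terminates on every instance. An empty register cannot be decremented, so \<open>DEC\<close> is
  used only in loops that test its register.\<close>

inductive exec :: "com \<Rightarrow> (nat \<Rightarrow> nat) \<Rightarrow> (nat \<Rightarrow> nat) \<Rightarrow> bool" where
  skip: "exec SKIP s s"
| inc: "exec (INC r) s (s(r := Suc (s r)))"
| dec: "s r = Suc n \<Longrightarrow> exec (DEC r) s (s(r := n))"
| seq: "exec c s t \<Longrightarrow> exec d t u \<Longrightarrow> exec (SEQ c d) s u"
| while0: "s r = 0 \<Longrightarrow> exec (WHILE r c) s s"
| whileSuc: "0 < s r \<Longrightarrow> exec c s t \<Longrightarrow> exec (WHILE r c) t u \<Longrightarrow> exec (WHILE r c) s u"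

lemma exec_eq: "exec c s t \<Longrightarrow> t = u \<Longrightarrow> exec c s u"
  by simp

definition clear :: "nat \<Rightarrow> com" where
  "clear r = WHILE r (DEC r)"

lemma exec_clear: "exec (clear r) s (s(r := 0))"
proof (induction "s r" arbitrary: s)
  case 0
  then have eq: "s(r := 0) = s" by auto
  show ?case unfolding clear_def eq by (rule exec.while0) (use 0 in simp)
next
  case (Suc n)
  have "exec (clear r) (s(r := n)) (s(r := 0))" using Suc.hyps(1)[of "s(r := n)"] by simp
  moreover have "exec (DEC r) s (s(r := n))"
    by (rule exec.dec) (simp add: Suc.hyps(2))
  ultimately show ?case
    unfolding clear_def using Suc.hyps(2) by (metis exec.whileSuc zero_less_Suc)
qed

fun clears :: "nat \<Rightarrow> nat \<Rightarrow> com" where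
  "clears i 0 = SKIP"
| "clears i (Suc n) = SEQ (clear i) (clears (Suc i) n)"

lemma exec_clears: "exec (clears i n) s (\<lambda>j. if i \<le> j \<and> j < i + n then 0 else s j)"
proof (induction n arbitrary: i s)
  case 0
  show ?case unfolding clears.simps by (rule exec_eq[OF exec.skip]) auto
next
  case (Suc n)
  show ?case
    unfolding clears.simps by (rule exec.seq[OF exec_clear exec_eq[OF Suc]]) (auto simp: fun_eq_iff)
qed

definition move :: "nat \<Rightarrow> nat \<Rightarrow> com" where
  "move r q = WHILE r (SEQ (DEC r) (INC q))"

lemma exec_move:
  assumes "r \<noteq> q"
  shows "exec (move r q) s (s(r := 0, q := s q + s r))"
proof (induction "s r" arbitrary: s)
  case 0
  then have eq: "s(r := 0, q := s q + s r) = s" by (auto simp: fun_eq_iff)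
  show ?case unfolding move_def eq by (rule exec.while0) (use 0 in simp)
next
  case (Suc n)
  let ?t = "s(r := n, q := Suc (s q))"
  have "exec (SEQ (DEC r) (INC q)) s ?t"
    by (rule exec.seq[OF exec.dec exec_eq[OF exec.inc]])
      (use Suc.hyps(2)[symmetric] assms in \<open>auto simp: fun_eq_iff\<close>)
  moreover have "exec (move r q) ?t (s(r := 0, q := s q + s r))"
    by (rule exec_eq[OF Suc.hyps(1)]) (use Suc.hyps(2)[symmetric] assms in \<open>auto simp: fun_eq_iff\<close>)
  ultimately show ?case
    unfolding move_def using Suc.hyps(2) by (metis exec.whileSuc zero_less_Suc)
qed

text \<open>Counting a register down destroys it, so its content is duplicated into the empty
  register \<open>t\<close> and moved back.\<close>

definition copy :: "nat \<Rightarrow> nat \<Rightarrow> nat \<Rightarrow> com" where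
  "copy r q t = SEQ (WHILE r (SEQ (DEC r) (SEQ (INC q) (INC t)))) (move t r)"

lemma exec_copy:
  assumes "distinct [r, q, t]" "s t = 0"
  shows "exec (copy r q t) s (s(q := s q + s r))"
proof -
  have "exec (WHILE r (SEQ (DEC r) (SEQ (INC q) (INC t)))) s
      (s(r := 0, q := s q + s r, t := s t + s r))" for s
  proof (induction "s r" arbitrary: s)
    case 0
    then have eq: "s(r := 0, q := s q + s r, t := s t + s r) = s" by (auto simp: fun_eq_iff)
    show ?case unfolding eq by (rule exec.while0) (use 0 in simp)
  next
    case (Suc n)
    let ?t = "s(r := n, q := Suc (s q), t := Suc (s t))"
    have "exec (SEQ (DEC r) (SEQ (INC q) (INC t))) s ?t"
      by (rule exec.seq[OF exec.dec exec.seq[OF exec.inc exec_eq[OF exec.inc]]])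
        (use Suc.hyps(2)[symmetric] assms in \<open>auto simp: fun_eq_iff\<close>)
    then show ?case
      by (rule exec.whileSuc[rotated, OF _ exec_eq[OF Suc.hyps(1)[of ?t]]])
        (use Suc.hyps(2)[symmetric] assms in \<open>auto simp: fun_eq_iff\<close>)
  qed
  then show ?thesis
    unfolding copy_def
    by (rule exec.seq[OF _ exec_eq[OF exec_move]]) (use assms in \<open>auto simp: fun_eq_iff\<close>)
qed

text \<open>The registers from \<open>k\<close> on are scratch space, zero before and after the execution.\<close>

fun compile :: "recf \<Rightarrow> nat list \<Rightarrow> nat \<Rightarrow> nat \<Rightarrow> com"
  and compiles :: "recf list \<Rightarrow> nat list \<Rightarrow> nat \<Rightarrow> nat \<Rightarrow> com" where
  "compile Zero args out k = SKIP"
| "compile Succ args out k = SEQ (copy (hd args) out k) (INC out)"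
| "compile (Proj i) args out k = copy (args ! i) out k"
| "compile (Comp f gs) args out k =
     (let k' = k + length gs in
      SEQ (compiles gs args k k') (SEQ (compile f [k..<k'] out k') (clears k (length gs))))"
| "compile (PrimRec f g) args out k =
     SEQ (copy (hd args) (k + 1) (k + 2))
    (SEQ (compile f (tl args) out (k + 3))
    (SEQ (WHILE (k + 1)
       (SEQ (DEC (k + 1))
       (SEQ (compile g (out # k # tl args) (k + 2) (k + 3))
       (SEQ (clear out)
       (SEQ (move (k + 2) out)
            (INC k))))))
     (clear k)))"
| "compile (Mu f) args out k =
     SEQ (compile f (out # args) k (k + 1))
     (WHILE k (SEQ (clear k) (SEQ (INC out) (compile f (out # args) k (k + 1)))))"
| "compiles [] args i k = SKIP"
| "compiles (g # gs) args i k = SEQ (compile g args i k) (compiles gs args (Suc i) k)"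

text \<open>The output register has to be zero on entry because \<open>copy\<close> adds to it and
  minimisation counts in it from \<open>0\<close>.\<close>

definition compiled :: "recf \<Rightarrow> bool" where
  "compiled f \<longleftrightarrow> (\<forall>args out k s y.
     reval f (map s args) y \<longrightarrow> s out = 0 \<longrightarrow> out \<notin> set args \<longrightarrow> out < k \<longrightarrow>
     (\<forall>a\<in>set args. a < k) \<longrightarrow> (\<forall>j\<ge>k. s j = 0) \<longrightarrow>
     exec (compile f args out k) s (s(out := y)))"

lemma compiledD:
  assumes "compiled f" "reval f xs y" "map s args = xs" "s out = 0" "out \<notin> set args" "out < k"
    "\<And>a. a \<in> set args \<Longrightarrow> a < k" "\<And>j. k \<le> j \<Longrightarrow> s j = 0"
  shows "exec (compile f args out k) s (s(out := y))"
  using assms unfolding compiled_def by blast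

text \<open>Each result goes into the first register of a zero block, so the rest of the block stays
  zero and the arguments below it stay intact for the next function.\<close>

lemma exec_compiles:
  assumes "list_all2 (\<lambda>g y. reval g xs y) gs ys" "\<And>g. g \<in> set gs \<Longrightarrow> compiled g"
    and "map s args = xs" "\<And>a. a \<in> set args \<Longrightarrow> a < i" "i + length gs \<le> k" "\<And>j. i \<le> j \<Longrightarrow> s j = 0"
  shows "exec (compiles gs args i k) s
    (\<lambda>j. if i \<le> j \<and> j < i + length gs then ys ! (j - i) else s j)"
  using assms
proof (induction gs ys arbitrary: i s rule: list_all2_induct)
  case Nil
  show ?case unfolding compiles.simps by (rule exec_eq[OF exec.skip]) auto
next
  case (Cons g gs y ys)
  have arg_less: "a < i" if "a \<in> set args" for a using Cons.prems(3) that by blast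
  have "exec (compile g args i k) s (s(i := y))"
    using Cons.prems Cons.hyps(1) arg_less
    by (intro compiledD[of _ xs]) (auto simp: order_less_imp_le intro: less_le_trans dest: arg_less)
  moreover have "map (s(i := y)) args = xs"
    using Cons.prems(2) arg_less by (auto dest: arg_less)
  then have "exec (compiles gs args (Suc i) k) (s(i := y))
      (\<lambda>j. if Suc i \<le> j \<and> j < Suc i + length gs then ys ! (j - Suc i) else (s(i := y)) j)"
    using Cons.prems arg_less by (intro Cons.IH) (auto intro: less_SucI)
  ultimately show ?case
    unfolding compiles.simps
    by (rule exec.seq[OF _ exec_eq]) (auto simp: fun_eq_iff nth_Cons' not_less_eq_eq)
qed

text \<open>A derivation for a recursion unfolds downwards from \<open>n\<close>, whereas the
  compiled loop counts upwards; the sequence \<open>h\<close> of values links the two.\<close>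

lemma reval_PrimRec_values:
  assumes "reval (PrimRec f g) (n # xs) y"
  shows "\<exists>h. reval f xs (h 0) \<and> (\<forall>i<n. reval g (h i # i # xs) (h (Suc i))) \<and> h n = y"
  using assms
proof (induction n arbitrary: y)
  case 0
  then have "reval f xs y" by (rule reval_elims(5))
  then show ?case by (intro exI[of _ "\<lambda>_. y"]) simp
next
  case (Suc n)
  from Suc.prems obtain z where z: "reval (PrimRec f g) (n # xs) z" "reval g (z # n # xs) y"
    by (rule reval_elims(6))
  from Suc.IH[OF z(1)] obtain h where
    "reval f xs (h 0)" "\<forall>i<n. reval g (h i # i # xs) (h (Suc i))" "h n = z" by blast
  with z(2) show ?case
    by (intro exI[of _ "h(Suc n := y)"]) (auto simp: less_Suc_eq)
qed

lemma compiled_Comp: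
  assumes "compiled f" "\<And>g. g \<in> set gs \<Longrightarrow> compiled g"
  shows "compiled (Comp f gs)"
  unfolding compiled_def
proof (intro allI impI)
  fix args and out k :: nat and s :: "nat \<Rightarrow> nat" and z :: nat
  assume *: "reval (Comp f gs) (map s args) z" "s out = 0" "out \<notin> set args" "out < k"
    "\<forall>a\<in>set args. a < k" "\<forall>j\<ge>k. s j = 0"
  let ?k = "k + length gs"
  from *(1) obtain ys where ys: "list_all2 (\<lambda>g y. reval g (map s args) y) gs ys" "reval f ys z"
    by (rule reval_elims(4))
  have len: "length ys = length gs" using ys(1) by (simp add: list_all2_lengthD)
  define t where "t = (\<lambda>j. if k \<le> j \<and> j < ?k then ys ! (j - k) else s j)"
  have "exec (compiles gs args k ?k) s t"
    unfolding t_def using ys(1) assms(2) * by (intro exec_compiles) auto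
  moreover have "exec (compile f [k..<?k] out ?k) t (t(out := z))"
    using assms(1) ys(2) by (rule compiledD) (use * len in \<open>auto simp: t_def intro!: nth_equalityI\<close>)
  moreover have "exec (clears k (length gs)) (t(out := z)) (s(out := z))"
    by (rule exec_eq[OF exec_clears]) (use * in \<open>auto simp: t_def fun_eq_iff\<close>)
  ultimately show "exec (compile (Comp f gs) args out k) s (s(out := z))"
    unfolding compile.simps Let_def by (intro exec.seq)
qed

lemma compiled_PrimRec:
  assumes "compiled f" "compiled g"
  shows "compiled (PrimRec f g)"
  unfolding compiled_def
proof (intro allI impI)
  fix args and out k :: nat and s :: "nat \<Rightarrow> nat" and y :: nat
  assume *: "reval (PrimRec f g) (map s args) y" "s out = 0" "out \<notin> set args" "out < k"
    "\<forall>a\<in>set args. a < k" "\<forall>j\<ge>k. s j = 0"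
  from *(1) have "args \<noteq> []" by cases auto
  then obtain b bs where args: "args = b # bs" by (cases args) auto
  define n where "n = s b"
  have mem: "a < k" "a \<noteq> out" if "a \<in> set bs" for a using * args that by auto
  obtain h where h: "reval f (map s bs) (h 0)"
    "\<And>i. i < n \<Longrightarrow> reval g (h i # i # map s bs) (h (Suc i))" "h n = y"
    using reval_PrimRec_values[of f g n "map s bs" y] *(1) by (auto simp: args n_def)
  \<comment> \<open>The state after \<open>i\<close> rounds: \<open>k\<close> holds the recursion
    index and \<open>k + 1\<close> the number of rounds left. Register \<open>k + 2\<close> receives
    the next value first, because \<open>out\<close> is still an argument of
    \<open>g\<close>.\<close>
  define t where "t i = s(out := h i, k := i, k + 1 := n - i)" for i
  let ?body = "SEQ (DEC (k + 1)) (SEQ (compile g (out # k # bs) (k + 2) (k + 3))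
    (SEQ (clear out) (SEQ (move (k + 2) out) (INC k))))"
  have body: "exec ?body (t i) (t (Suc i))" if "i < n" for i
  proof (rule exec.seq)
    let ?u = "(t i)(k + 1 := n - Suc i)"
    show "exec (DEC (k + 1)) (t i) ?u"
      by (rule exec.dec) (use that in \<open>auto simp: t_def Suc_diff_Suc\<close>)
    have "exec (compile g (out # k # bs) (k + 2) (k + 3)) ?u (?u(k + 2 := h (Suc i)))"
      using assms(2) h(2)[OF that]
      by (rule compiledD) (use * mem in \<open>force simp: t_def\<close>)+
    moreover have "exec (SEQ (clear out) (SEQ (move (k + 2) out) (INC k)))
        (?u(k + 2 := h (Suc i))) (t (Suc i))"
      by (rule exec.seq[OF exec_clear exec.seq[OF exec_move exec_eq[OF exec.inc]]])
        (use * in \<open>auto simp: t_def fun_eq_iff\<close>)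
    ultimately show "exec (SEQ (compile g (out # k # bs) (k + 2) (k + 3))
        (SEQ (clear out) (SEQ (move (k + 2) out) (INC k)))) ?u (t (Suc i))"
      by (rule exec.seq)
  qed
  have loop: "exec (WHILE (k + 1) ?body) (t i) (t n)" if "i \<le> n" for i
    using that
  proof (induction i rule: inc_induct)
    case base
    show ?case by (rule exec.while0) (simp add: t_def)
  next
    case (step i)
    then show ?case by (intro exec.whileSuc[OF _ body[of i] step.IH]) (auto simp: t_def)
  qed
  have init: "exec (copy b (k + 1) (k + 2)) s (s(k + 1 := n))"
    by (rule exec_eq[OF exec_copy]) (use * args in \<open>auto simp: n_def\<close>)
  have "exec (compile f bs out (k + 3)) (s(k + 1 := n)) ((s(k + 1 := n))(out := h 0))"
    using assms(1) h(1)
    by (rule compiledD) (use * mem in force)+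
  then have start: "exec (compile f bs out (k + 3)) (s(k + 1 := n)) (t 0)"
    by (rule exec_eq) (use * in \<open>auto simp: t_def fun_eq_iff\<close>)
  have stop: "exec (clear k) (t n) (s(out := y))"
    by (rule exec_eq[OF exec_clear]) (use * h(3) in \<open>auto simp: t_def fun_eq_iff\<close>)
  show "exec (compile (PrimRec f g) args out k) s (s(out := y))"
    unfolding compile.simps args list.sel
    by (rule exec.seq[OF init exec.seq[OF start exec.seq[OF loop[OF le0] stop]]])
qed

lemma compiled_Mu:
  assumes "compiled f"
  shows "compiled (Mu f)"
  unfolding compiled_def
proof (intro allI impI)
  fix args and out k :: nat and s :: "nat \<Rightarrow> nat" and n :: nat
  assume *: "reval (Mu f) (map s args) n" "s out = 0" "out \<notin> set args" "out < k"
    "\<forall>a\<in>set args. a < k" "\<forall>j\<ge>k. s j = 0"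
  from *(1) have n: "reval f (n # map s args) 0" "\<forall>m<n. \<exists>y>0. reval f (m # map s args) y"
    by (auto elim: reval_elims(7))
  then obtain h where h: "\<And>m. m < n \<Longrightarrow> 0 < h m \<and> reval f (m # map s args) (h m)" by metis
  \<comment> \<open>The value \<open>0\<close> at \<open>n\<close> ends the loop and also leaves the
    scratch register \<open>k\<close> empty.\<close>
  define h' where "h' m = (if m < n then h m else 0)" for m
  have h': "reval f (m # map s args) (h' m)" if "m \<le> n" for m
    using that n(1) h by (auto simp: h'_def le_less)
  have call: "exec (compile f (out # args) k (k + 1)) (s(out := m)) (s(out := m, k := h' m))"
    if "m \<le> n" for m
    using assms h'[OF that]
    by (rule compiledD) (use * in force)+
  let ?body = "SEQ (clear k) (SEQ (INC out) (compile f (out # args) k (k + 1)))"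
  have loop: "exec (WHILE k ?body) (s(out := m, k := h' m)) (s(out := n))" if "m \<le> n" for m
    using that
  proof (induction m rule: inc_induct)
    case base
    have eq: "s(out := n, k := h' n) = s(out := n)" using * by (auto simp: h'_def fun_eq_iff)
    show ?case unfolding eq by (rule exec.while0) (use * in simp)
  next
    case (step m)
    have "(s(out := m, k := h' m))(k := 0) = s(out := m)"
      using * by (auto simp: fun_eq_iff)
    then have "exec (clear k) (s(out := m, k := h' m)) (s(out := m))"
      by (rule exec_eq[OF exec_clear])
    moreover have "exec (INC out) (s(out := m)) (s(out := Suc m))"
      by (rule exec_eq[OF exec.inc]) simp
    ultimately have body: "exec ?body (s(out := m, k := h' m)) (s(out := Suc m, k := h' (Suc m)))"
      using call[of "Suc m"] step.hyps by (auto intro: exec.seq)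
    have "0 < h' m" using h step.hyps by (simp add: h'_def)
    then show ?case by (intro exec.whileSuc[OF _ body step.IH]) simp
  qed
  have "s(out := 0) = s" using *(2) by auto
  then show "exec (compile (Mu f) args out k) s (s(out := n))"
    unfolding compile.simps using exec.seq[OF call[OF le0] loop[OF le0]] by simp
qed

lemma compile_correct: "compiled f"
proof (induction f)
  case Zero
  show ?case
    unfolding compiled_def
    by (auto elim!: reval_elims(1) intro!: exec_eq[OF exec.skip] simp: fun_eq_iff)
next
  case Succ
  have "exec (SEQ (copy a out k) (INC out)) s (s(out := Suc (s a)))"
    if "s out = 0" "a \<noteq> out" "out < k" "a < k" "s k = 0" for a out k s
    using that by (intro exec.seq[OF exec_copy] exec_eq[OF exec.inc]) auto
  then show ?case
    unfolding compiled_def by (auto elim!: reval_elims(2) simp: map_eq_Cons_conv)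
next
  case (Proj i)
  have "exec (copy a out k) s (s(out := s a))"
    if "s out = 0" "a \<noteq> out" "out < k" "a < k" "s k = 0" for a out k s
    using that by (intro exec_eq[OF exec_copy]) auto
  then show ?case
    unfolding compiled_def
    by (auto elim!: reval_elims(3)) (metis nth_mem order_refl)
qed (auto intro: compiled_Comp compiled_PrimRec compiled_Mu)


subsection \<open>Flat programs\<close>

datatype instr = Add nat int nat | JZ nat nat nat

text \<open>Addresses are also locations of the automaton, where \<open>0\<close>, \<open>1\<close>
  and \<open>2\<close> have special roles; hence \<open>3 \<le> l\<close>, and the machine halts at
  \<open>2\<close>.\<close>

inductive mstep :: "instr list \<Rightarrow> nat \<times> (nat \<Rightarrow> nat) \<Rightarrow> nat \<times> (nat \<Rightarrow> nat) \<Rightarrow> bool"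
  for P where
  add: "3 \<le> l \<Longrightarrow> l < length P \<Longrightarrow> P ! l = Add r d a \<Longrightarrow> 0 \<le> int (s r) + d \<Longrightarrow>
    mstep P (l, s) (a, s(r := nat (int (s r) + d)))"
| jz: "3 \<le> l \<Longrightarrow> l < length P \<Longrightarrow> P ! l = JZ r a b \<Longrightarrow>
    mstep P (l, s) (if s r = 0 then a else b, s)"

lemma mstep_deterministic: "mstep P x y \<Longrightarrow> mstep P x z \<Longrightarrow> y = z"
  by (elim mstep.cases) auto

text \<open>The second argument is the absolute address of the first instruction.
  \<open>JZ r n n\<close> is an unconditional jump back to the test, and
  \<open>n + length p + 2\<close> is the address after the loop.\<close>

fun code :: "com \<Rightarrow> nat \<Rightarrow> instr list" where
  "code SKIP n = []"
| "code (INC r) n = [Add r 1 (Suc n)]"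
| "code (DEC r) n = [Add r (-1) (Suc n)]"
| "code (SEQ c d) n = (let p = code c n in p @ code d (n + length p))"
| "code (WHILE r c) n =
     (let p = code c (Suc n) in JZ r (n + length p + 2) (Suc n) # p @ [JZ r n n])"

lemma Add_in_code: "Add r d a \<in> set (code c n) \<Longrightarrow> \<bar>d\<bar> \<le> 1"
  by (induction c arbitrary: n) (auto simp: Let_def)

lemma code_correct:
  assumes "exec c s t" "P = pre @ code c (length pre) @ post" "3 \<le> length pre"
  shows "(mstep P)\<^sup>*\<^sup>* (length pre, s) (length pre + length (code c (length pre)), t)"
  using assms
proof (induction arbitrary: pre post rule: exec.induct)
  case (skip s)
  then show ?case by simp
next
  case (inc r s)
  then have "mstep P (length pre, s) (Suc (length pre), s(r := nat (int (s r) + 1)))"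
    by (intro mstep.add) auto
  moreover have "nat (int (s r) + 1) = Suc (s r)" by simp
  ultimately have "mstep P (length pre, s)
      (length pre + length (code (INC r) (length pre)), s(r := Suc (s r)))" by simp
  then show ?case by (rule r_into_rtranclp)
next
  case (dec s r n)
  then have "mstep P (length pre, s) (Suc (length pre), s(r := nat (int (s r) + -1)))"
    by (intro mstep.add) auto
  then have "mstep P (length pre, s)
      (length pre + length (code (DEC r) (length pre)), s(r := n))"
    using dec.hyps by simp
  then show ?case by (rule r_into_rtranclp)
next
  case (seq c s t d u)
  let ?p = "code c (length pre)"
  let ?q = "code d (length pre + length ?p)"
  have "(mstep P)\<^sup>*\<^sup>* (length pre, s) (length pre + length ?p, t)"
    using seq.prems by (intro seq.IH(1)[of _ "?q @ post"]) (auto simp: Let_def)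
  moreover have "(mstep P)\<^sup>*\<^sup>* (length pre + length ?p, t) (length pre + length ?p + length ?q, u)"
    using seq.IH(2)[of "pre @ ?p" post] seq.prems by (auto simp: Let_def)
  ultimately show ?case by (auto simp: Let_def add.assoc)
next
  case (while0 s r c)
  then have "mstep P (length pre, s)
      (if s r = 0 then length pre + length (code c (Suc (length pre))) + 2 else Suc (length pre), s)"
    by (intro mstep.jz) (auto simp: Let_def)
  then show ?case using while0 by (auto simp: Let_def)
next
  case (whileSuc s r c t u)
  let ?n = "length pre"
  let ?p = "code c (Suc ?n)"
  let ?jz = "JZ r (?n + length ?p + 2) (Suc ?n)"
  have "mstep P (?n, s) (if s r = 0 then ?n + length ?p + 2 else Suc ?n, s)"
    using whileSuc.prems by (intro mstep.jz) (auto simp: Let_def)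
  then have "mstep P (?n, s) (Suc ?n, s)" using whileSuc.hyps by simp
  also have "(mstep P)\<^sup>*\<^sup>* (Suc ?n, s) (Suc ?n + length ?p, t)"
    using whileSuc.IH(1)[of "pre @ [?jz]" "JZ r ?n ?n # post"] whileSuc.prems
    by (auto simp: Let_def)
  also have "mstep P (Suc ?n + length ?p, t) (if t r = 0 then ?n else ?n, t)"
    using whileSuc.prems by (intro mstep.jz) (auto simp: Let_def nth_append)
  then have "mstep P (Suc ?n + length ?p, t) (?n, t)" by simp
  also have "(mstep P)\<^sup>*\<^sup>* (?n, t) (?n + length (code (WHILE r c) ?n), u)"
    using whileSuc.prems by (intro whileSuc.IH(2))
  finally show ?case .
qed


subsection \<open>Simulation by a parametric timed automaton\<close>

text \<open>Every parameter gets the value \<open>q\<close>; for atoms over the single parameter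
  \<open>0\<close> this agrees with substitution, by \<open>sat_subst\<close>.\<close>

fun psat_atom :: "rat \<Rightarrow> (nat \<Rightarrow> real) \<Rightarrow> (nat, nat) patom \<Rightarrow> bool" where
  "psat_atom q w (ClockParam x r p k) \<longleftrightarrow> cmp_rel r (w x) (of_rat q + of_int k)"
| "psat_atom q w (ClockConst x r k) \<longleftrightarrow> cmp_rel r (w x) (of_int k)"
| "psat_atom q w (ParamConst p r k) \<longleftrightarrow> cmp_rel r (of_rat q) (of_int k)"

text \<open>This guard is on all edges except the cheating ones and the loop at \<open>2\<close>, so
  that \<open>2\<close> cannot be entered for parameter value \<open>0\<close>.\<close>

definition positive :: "(nat, nat) patom" where
  "positive = ParamConst 0 Gt 0"

type_synonym pedge = "(nat, nat, nat, (nat, nat) patom) edge"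

text \<open>
  Clock \<open>0\<close> measures cycles of length \<open>p\<close>, and clock \<open>Suc j\<close> shows the content of register \<open>j\<close>
  whenever clock \<open>0\<close> is \<open>0\<close>. In each cycle, clock \<open>Suc j\<close> is reset when it reaches \<open>p\<close>, and adding \<open>d\<close>
  to a register amounts to a reset at \<open>p - d\<close> instead.
\<close>

fun instr_edges :: "nat \<Rightarrow> nat \<Rightarrow> instr \<Rightarrow> pedge set" where
  "instr_edges N l (Add r d a) =
     insert (l, positive # ClockParam 0 Eq 0 0 # map (\<lambda>j. ClockParam (Suc j) Lt 0 0) [0..<N], 0, {0}, a)
      ((\<lambda>j. (l, [positive, ClockParam (Suc j) Eq 0 (if j = r then - d else 0)], 0, {Suc j}, l)) ` {..<N})"
| "instr_edges N l (JZ r a b) =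
     {(l, [positive, ClockConst 0 Eq 0, ClockConst (Suc r) Eq 0], 0, {}, a),
      (l, [positive, ClockConst 0 Eq 0, ClockConst (Suc r) Gt 0], 0, {}, b)}"

text \<open>
  The edges guarded by \<open>z > p\<close>, where \<open>z\<close> is clock \<open>0\<close>, make all infinite sequences of locations
  other than \<open>2\<close> possible, for every value of the parameter. Hence the traces depend on \<open>p\<close> only if
  location \<open>2\<close> can be reached, which requires a faithful simulation.
\<close>

definition base_edges :: "instr list \<Rightarrow> nat \<Rightarrow> pedge set" where
  "base_edges P N =
     (\<lambda>(l, l'). (l, [ClockParam 0 Gt 0 0], 0, {}, l')) ` (({..<N} - {2}) \<times> ({..<N} - {2})) \<union>
     {(2, [], 0, {}, 2), (1, [positive, ClockConst 0 Eq 0], 0, Suc ` {1..<N}, 3)} \<union>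
     (\<Union>l\<in>{3..<length P}. instr_edges N l (P ! l)) \<union>
     (\<lambda>(l, j). (l, [positive, ClockConst 0 Eq 0, ClockParam (Suc j) Ge 0 (- 2)], 0, {}, 2)) `
       ({3..<length P} \<times> {..<N})"

text \<open>Resetting clock \<open>0\<close> when clock \<open>1\<close> reads \<open>c\<close>
  begins a cycle in which register \<open>0\<close> holds \<open>c\<close>. The edge from
  \<open>1\<close> to \<open>3\<close> then clears the other registers.\<close>

definition load_edge :: "nat \<Rightarrow> pedge" where
  "load_edge c = (0, [positive, ClockConst 1 Eq (int c)], 0, {0}, 1)"

definition simulator_edges :: "instr list \<Rightarrow> nat \<Rightarrow> nat \<Rightarrow> pedge set" where
  "simulator_edges P N c = insert (load_edge c) (base_edges P N)"

definition simulator :: "instr list \<Rightarrow> nat \<Rightarrow> nat \<Rightarrow> (nat, nat, nat, nat) pta" where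
  "simulator P N c =
     \<lparr>actions = {0}, locs = {..<c}, init_loc = 0, clocks = {..<c}, invar = (\<lambda>_. []),
      edges = simulator_edges P N c, params = {0}\<rparr>"

fun instr_ok :: "nat \<Rightarrow> instr \<Rightarrow> bool" where
  "instr_ok N (Add r d a) \<longleftrightarrow> r < N \<and> a < N \<and> \<bar>d\<bar> \<le> 1"
| "instr_ok N (JZ r a b) \<longleftrightarrow> r < N \<and> a < N \<and> b < N"

lemma base_edges_cases:
  assumes "(l, g, a, R, l') \<in> base_edges P N"
  obtains (cheat) "l < N" "l \<noteq> 2" "l' < N" "l' \<noteq> 2" "g = [ClockParam 0 Gt 0 0]" "R = {}" "a = 0"
  | (special) "l = 2" "l' = 2" "g = []" "R = {}" "a = 0"
  | (start) "l = 1" "l' = 3" "g = [positive, ClockConst 0 Eq 0]" "R = Suc ` {1..<N}" "a = 0"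
  | (cycle) r d b where "3 \<le> l" "l < length P" "P ! l = Add r d b" "l' = b" "R = {0}" "a = 0"
      "g = positive # ClockParam 0 Eq 0 0 # map (\<lambda>j. ClockParam (Suc j) Lt 0 0) [0..<N]"
  | (refresh) r d b j where "3 \<le> l" "l < length P" "P ! l = Add r d b" "j < N" "l' = l" "R = {Suc j}"
      "g = [positive, ClockParam (Suc j) Eq 0 (if j = r then - d else 0)]" "a = 0"
  | (zero) r b b' where "3 \<le> l" "l < length P" "P ! l = JZ r b b'" "l' = b" "R = {}" "a = 0"
      "g = [positive, ClockConst 0 Eq 0, ClockConst (Suc r) Eq 0]"
  | (nonzero) r b b' where "3 \<le> l" "l < length P" "P ! l = JZ r b b'" "l' = b'" "R = {}" "a = 0"
      "g = [positive, ClockConst 0 Eq 0, ClockConst (Suc r) Gt 0]"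
  | (overflow) j where "3 \<le> l" "l < length P" "j < N" "l' = 2" "R = {}" "a = 0"
      "g = [positive, ClockConst 0 Eq 0, ClockParam (Suc j) Ge 0 (- 2)]"
  using assms unfolding base_edges_def
proof (elim UnE UN_E)
  assume "(l, g, a, R, l') \<in> (\<lambda>(l, l'). (l, [ClockParam 0 Gt 0 0], 0, {}, l')) `
    (({..<N} - {2}) \<times> ({..<N} - {2}))"
  then show ?thesis by (elim imageE) (rule cheat; auto)
next
  assume "(l, g, a, R, l') \<in> {(2, [], 0, {}, 2), (1, [positive, ClockConst 0 Eq 0], 0, Suc ` {1..<N}, 3)}"
  then consider "(l, g, a, R, l') = (2, [], 0, {}, 2)"
    | "(l, g, a, R, l') = (1, [positive, ClockConst 0 Eq 0], 0, Suc ` {1..<N}, 3)" by fast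
  then show ?thesis by cases (rule special, auto, rule start, auto)
next
  fix m assume "m \<in> {3..<length P}" and e: "(l, g, a, R, l') \<in> instr_edges N m (P ! m)"
  moreover have "l = m" using e by (cases "P ! m") auto
  ultimately have l: "3 \<le> l" "l < length P" "(l, g, a, R, l') \<in> instr_edges N l (P ! l)" by auto
  show ?thesis
  proof (cases "P ! l")
    case (Add r d b)
    from l(3) have "(l, g, a, R, l') = (l, positive # ClockParam 0 Eq 0 0 #
          map (\<lambda>j. ClockParam (Suc j) Lt 0 0) [0..<N], 0, {0}, b) \<or>
        (l, g, a, R, l') \<in> (\<lambda>j. (l, [positive, ClockParam (Suc j) Eq 0 (if j = r then - d else 0)],
          0, {Suc j}, l)) ` {..<N}"
      by (simp add: Add)
    then show ?thesis
    proof (elim disjE imageE)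
      assume "(l, g, a, R, l') = (l, positive # ClockParam 0 Eq 0 0 #
          map (\<lambda>j. ClockParam (Suc j) Lt 0 0) [0..<N], 0, {0}, b)"
      then show ?thesis by (intro cycle[OF l(1,2) Add]) simp_all
    next
      fix j assume "j \<in> {..<N}" "(l, g, a, R, l') =
          (l, [positive, ClockParam (Suc j) Eq 0 (if j = r then - d else 0)], 0, {Suc j}, l)"
      then show ?thesis by (intro refresh[OF l(1,2) Add, of j]) simp_all
    qed
  next
    case (JZ r b b')
    then show ?thesis using l(3) zero[OF l(1,2) JZ] nonzero[OF l(1,2) JZ] by (auto simp: JZ)
  qed
next
  assume "(l, g, a, R, l') \<in>
    (\<lambda>(l, j). (l, [positive, ClockConst 0 Eq 0, ClockParam (Suc j) Ge 0 (- 2)], 0, {}, 2)) `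
      ({3..<length P} \<times> {..<N})"
  then obtain j where "3 \<le> l" "l < length P" "j < N" "l' = 2" "R = {}" "a = 0"
    "g = [positive, ClockConst 0 Eq 0, ClockParam (Suc j) Ge 0 (- 2)]" by auto
  then show ?thesis by (rule overflow)
qed

lemma finite_base_edges: "finite (base_edges P N)"
proof -
  have "finite (instr_edges N l i)" for l i
    by (cases i) auto
  then show ?thesis unfolding base_edges_def by auto
qed

text \<open>\<open>N\<close> bounds both the locations and the registers. Registers occupy the
  clocks \<open>1\<close> to \<open>N\<close>, so \<open>N < c\<close> makes everything fit into the
  padded sets \<open>{..<c}\<close>.\<close>

locale simulation =
  fixes P :: "instr list" and N c :: nat
  assumes bound: "4 \<le> N" "length P \<le> N" "\<And>i. i \<in> set P \<Longrightarrow> instr_ok N i"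
    and less: "N < c"
begin

abbreviation "E \<equiv> simulator_edges P N c"

lemma instr_ok_nth: "l < length P \<Longrightarrow> instr_ok N (P ! l)"
  using bound(3) nth_mem by blast

lemma edge_bounds:
  assumes "(l, g, a, R, l') \<in> E"
  shows "l < N" "l' < N" "a = 0" "R \<subseteq> {..N}" "\<forall>b\<in>set g. atom_over {..N} {0} b"
proof -
  note simps = positive_def image_subset_iff subset_iff
  have "l < N \<and> l' < N \<and> a = 0 \<and> R \<subseteq> {..N} \<and> (\<forall>b\<in>set g. atom_over {..N} {0} b)"
  proof (cases "(l, g, a, R, l') = load_edge c")
    case True
    then show ?thesis using bound unfolding load_edge_def by (auto simp: simps)
  next
    case False
    then have "(l, g, a, R, l') \<in> base_edges P N" using assms by (simp add: simulator_edges_def)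
    then show ?thesis
      using bound(1,2) instr_ok_nth[of l]
      by (cases rule: base_edges_cases) (auto simp: simps)
  qed
  then show "l < N" "l' < N" "a = 0" "R \<subseteq> {..N}" "\<forall>b\<in>set g. atom_over {..N} {0} b"
    by auto
qed

lemma is_pta_simulator: "is_pta (simulator P N c)"
proof -
  have mono: "atom_over {..N} {0} b \<Longrightarrow> atom_over {..<c} {0} b" for b :: "(nat, nat) patom"
    using less by (cases b) auto
  have "l < c \<and> l' < c \<and> a = 0 \<and> R \<subseteq> {..<c} \<and> (\<forall>b\<in>set g. atom_over {..<c} {0} b)"
    if "(l, g, a, R, l') \<in> E" for l g a R l'
    using edge_bounds[OF that] less mono by fastforce
  then have "\<forall>(l, g, a, R, l')\<in>E. l \<in> {..<c} \<and> l' \<in> {..<c} \<and> a \<in> {0} \<and> R \<subseteq> {..<c} \<and>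
      (\<forall>b\<in>set g. atom_over {..<c} {0} b)"
    by (simp only: Ball_def split_paired_All prod.case lessThan_iff singleton_iff) blast
  moreover have "finite E" using finite_base_edges by (simp add: simulator_edges_def)
  ultimately show ?thesis
    unfolding is_pta_def simulator_def using less by simp
qed

section \<open>Steps and reachable configurations of the simulator\<close>

definition pstep :: "rat \<Rightarrow> nat \<times> (nat \<Rightarrow> real) \<Rightarrow> nat \<times> (nat \<Rightarrow> real) \<Rightarrow> bool" where
  "pstep q s s' \<longleftrightarrow> (\<exists>d g R. 0 \<le> d \<and> (fst s, g, 0, R, fst s') \<in> E \<and>
     (\<forall>b\<in>set g. psat_atom q (delay (snd s) d) b) \<and> snd s' = reset (delay (snd s) d) R)"

lemma pstepI:
  assumes "(l, g, 0, R, l') \<in> E" "0 \<le> d" "\<And>b. b \<in> set g \<Longrightarrow> psat_atom q (delay w d) b"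
    "w' = reset (delay w d) R"
  shows "pstep q (l, w) (l', w')"
  using assms unfolding pstep_def by auto

lemma sat_subst: "sat w (map (subst_atom v) g) \<longleftrightarrow> (\<forall>b\<in>set g. psat_atom (v 0) w b)"
  if "\<forall>b\<in>set g. atom_over X {0} b"
proof -
  have "sat_atom w (subst_atom v b) \<longleftrightarrow> psat_atom (v 0) w b" if "atom_over X {0} b" for b
    using that by (cases b) (auto simp: of_rat_add)
  then show ?thesis using that unfolding sat_def by auto
qed

lemma is_config_simulator: "is_config (instantiate v (simulator P N c)) s \<longleftrightarrow> fst s < c"
  by (simp add: is_config_def instantiate_def simulator_def sat_def)

lemma edges_instantiate:
  "e \<in> edges (instantiate v (simulator P N c)) \<longleftrightarrow>
    (\<exists>l g a R l'. (l, g, a, R, l') \<in> E \<and> e = (l, map (subst_atom v) g, a, R, l'))"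
  by (simp add: instantiate_def simulator_def image_iff Bex_def split_paired_Ex)

lemma step_simulator_iff:
  "step (instantiate v (simulator P N c)) s d e s' \<longleftrightarrow>
    0 \<le> d \<and> (\<exists>g R. (fst s, g, 0, R, fst s') \<in> E \<and>
      e = (fst s, map (subst_atom v) g, 0, R, fst s') \<and>
      (\<forall>b\<in>set g. psat_atom (v 0) (delay (snd s) d) b) \<and> snd s' = reset (delay (snd s) d) R)"
  (is "?L \<longleftrightarrow> ?R")
proof
  assume ?L
  then obtain l w g a R l' w' where *: "s = (l, w)" "s' = (l', w')"
    "e = (l, map (subst_atom v) g, a, R, l')" "(l, g, a, R, l') \<in> E" "0 \<le> d"
    "sat (delay w d) (map (subst_atom v) g)" "w' = reset (delay w d) R"
    unfolding step_def edges_instantiate by blast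
  then show ?R using edge_bounds[OF *(4)] sat_subst by auto
next
  assume ?R
  then obtain g R where *: "0 \<le> d" "(fst s, g, 0, R, fst s') \<in> E"
    "e = (fst s, map (subst_atom v) g, 0, R, fst s')"
    "\<forall>b\<in>set g. psat_atom (v 0) (delay (snd s) d) b" "snd s' = reset (delay (snd s) d) R"
    by blast
  have "e \<in> edges (instantiate v (simulator P N c))"
    using *(2,3) unfolding edges_instantiate by blast
  moreover have "sat (delay (snd s) d) (map (subst_atom v) g)"
    using edge_bounds[OF *(2)] *(4) sat_subst by blast
  moreover have "fst s < c" "fst s' < c" using edge_bounds[OF *(2)] less by auto
  ultimately show ?L
    unfolding step_def is_config_simulator using * by (cases s; cases s') simp
qed

lemma step_iff_pstep:
  "(\<exists>d e. step (instantiate v (simulator P N c)) s d e s') \<longleftrightarrow> pstep (v 0) s s'"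
  unfolding step_simulator_iff pstep_def by auto

lemma cheat_edge: "l < N \<Longrightarrow> l \<noteq> 2 \<Longrightarrow> l' < N \<Longrightarrow> l' \<noteq> 2 \<Longrightarrow>
    (l, [ClockParam 0 Gt 0 0], 0, {}, l') \<in> E"
  unfolding simulator_edges_def base_edges_def by auto

lemma special_edge: "(2, [], 0, {}, 2) \<in> E"
  unfolding simulator_edges_def base_edges_def by auto

lemma pstep_total:
  assumes "fst s < N"
  shows "\<exists>s'. pstep q s s'"
proof (cases "fst s = 2")
  case True
  then have "pstep q s (2, delay (snd s) 0)"
    using special_edge unfolding pstep_def by (intro exI[of _ 0]) (force simp: reset_def)
  then show ?thesis by blast
next
  case False
  \<comment> \<open>Long enough for clock \<open>0\<close> to exceed \<open>q\<close> from any
    present value, which enables a cheating edge.\<close>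
  define d where "d = \<bar>of_rat q - snd s 0\<bar> + 1"
  have "pstep q (fst s, snd s) (fst s, reset (delay (snd s) d) {})"
    by (rule pstepI[OF cheat_edge]) (use False assms in \<open>auto simp: d_def delay_def\<close>)
  then show ?thesis by auto
qed

definition reachable :: "rat \<Rightarrow> nat \<times> (nat \<Rightarrow> real) \<Rightarrow> bool" where
  "reachable q s \<longleftrightarrow> (pstep q)\<^sup>*\<^sup>* (0, \<lambda>_. 0) s"

lemma reachable_less: "reachable q s \<Longrightarrow> fst s < N"
  unfolding reachable_def
proof (induction rule: rtranclp_induct)
  case base
  show ?case using bound by simp
next
  case (step s s')
  then show ?case unfolding pstep_def using edge_bounds(2) by blast
qed

lemma run_reachable:
  assumes "is_run (instantiate v (simulator P N c)) n s d e" "enat i \<le> n"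
  shows "reachable (v 0) (s i)"
  using assms(2)
proof (induction i)
  case 0
  have "s 0 = (0, \<lambda>_. 0)"
    using assms(1) unfolding is_run_def by (simp add: instantiate_def simulator_def)
  then show ?case unfolding reachable_def by simp
next
  case (Suc i)
  then have "enat i < n" by (simp add: Suc_ile_eq)
  then have "pstep (v 0) (s i) (s (Suc i))"
    using assms(1) unfolding is_run_def step_iff_pstep[symmetric] by blast
  then show ?case
    using Suc.IH \<open>enat i < n\<close> unfolding reachable_def by (simp add: order_less_imp_le)
qed

lemma run_infinite:
  assumes "is_run (instantiate v (simulator P N c)) n s d e"
  shows "n = \<infinity>"
proof (cases n)
  case (enat m)
  then have "reachable (v 0) (s m)" using run_reachable[OF assms] by simp
  then have "fst (s m) < N" by (rule reachable_less)
  then obtain s' where "pstep (v 0) (s m) s'" using pstep_total by blast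
  then show ?thesis using assms enat step_iff_pstep unfolding is_run_def by blast
qed

section \<open>Traces and reachability of location \<open>2\<close>\<close>

definition plain_traces :: "(nat \<Rightarrow> (nat \<times> nat) option) set" where
  "plain_traces = {\<lambda>i. Some (\<sigma> i, 0) | \<sigma>. \<sigma> 0 = 0 \<and> (\<forall>i. \<sigma> i < N \<and> \<sigma> i \<noteq> 2)}"

text \<open>All runs are infinite and stay below \<open>N\<close>. Conversely, cheating edges do not
  reset clock \<open>0\<close>, so one long delay in location \<open>0\<close> enables them forever
  and every sequence avoiding \<open>2\<close> is realised.\<close>

lemma Traces_unreachable:
  assumes "\<And>w. \<not> reachable (v 0) (2, w)"
  shows "Traces (instantiate v (simulator P N c)) = plain_traces" (is "Traces ?M = _")
proof (intro equalityI subsetI)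
  fix t assume "t \<in> Traces ?M"
  then obtain n s d e where t: "t = trace_of n s e" and run: "is_run ?M n s d e"
    unfolding Traces_def by blast
  have n: "n = \<infinity>" using run by (rule run_infinite)
  have "reachable (v 0) (s i)" for i using run_reachable[OF run] n by simp
  then have "fst (s i) < N \<and> fst (s i) \<noteq> 2" for i
    using reachable_less assms by (metis prod.collapse)
  moreover have "fst (s 0) = 0"
    using run unfolding is_run_def by (simp add: instantiate_def simulator_def)
  moreover have "edge_action (e i) = 0" for i
  proof -
    have "step ?M (s i) (d i) (e i) (s (Suc i))" using run n unfolding is_run_def by simp
    then show ?thesis unfolding step_simulator_iff edge_action_def by auto
  qed
  ultimately show "t \<in> plain_traces"
    unfolding plain_traces_def t n trace_of_def by (auto intro!: exI[of _ "\<lambda>i. fst (s i)"])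
next
  fix t assume "t \<in> plain_traces"
  then obtain \<sigma> where t: "t = (\<lambda>i. Some (\<sigma> i, 0))" and \<sigma>: "\<sigma> 0 = 0" "\<And>i. \<sigma> i < N" "\<And>i. \<sigma> i \<noteq> 2"
    unfolding plain_traces_def by blast
  define D where "D = \<bar>of_rat (v 0)\<bar> + (1::real)"
  have D: "of_rat (v 0) < D" "0 \<le> D"
    using abs_ge_self[of "of_rat (v 0) :: real"] unfolding D_def by linarith+
  define s where "s i = (\<sigma> i, \<lambda>_::nat. if i = 0 then 0 else D)" for i :: nat
  define d where "d i = (if i = 0 then D else 0)" for i :: nat
  define e where
    "e i = (\<sigma> i, map (subst_atom v) [ClockParam (0::nat) Gt 0 0], 0::nat, {} :: nat set, \<sigma> (Suc i))" for i
  have "step ?M (s i) (d i) (e i) (s (Suc i))" for i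
  proof -
    have "(fst (s i), [ClockParam 0 Gt 0 0], 0, {}, fst (s (Suc i))) \<in> E"
      using cheat_edge \<sigma> by (simp add: s_def)
    then show ?thesis
      unfolding step_simulator_iff using D
      by (auto simp: s_def d_def e_def delay_def reset_def intro!: exI[of _ "[ClockParam 0 Gt 0 0]"])
  qed
  then have "is_run ?M \<infinity> s d e"
    unfolding is_run_def is_config_simulator using \<sigma> less bound
    by (auto simp: s_def instantiate_def simulator_def)
  moreover have "trace_of \<infinity> s e = t"
    by (auto simp: trace_of_def t s_def e_def edge_action_def)
  ultimately show "t \<in> Traces ?M" unfolding Traces_def by blast
qed

text \<open>The loop at \<open>2\<close> prolongs a path to \<open>2\<close> into an infinite run,
  whose trace is not plain.\<close>

lemma Traces_reachable:
  assumes "reachable (v 0) (2, w)"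
  shows "Traces (instantiate v (simulator P N c)) \<noteq> plain_traces" (is "Traces ?M \<noteq> _")
proof -
  from assms obtain n where "(pstep (v 0) ^^ n) (0, \<lambda>_. 0) (2, w)"
    unfolding reachable_def by (auto simp: rtranclp_power)
  then obtain f where f: "f 0 = (0, \<lambda>_. 0)" "f n = (2, w)" "\<forall>i<n. pstep (v 0) (f i) (f (Suc i))"
    unfolding relpowp_fun_conv by blast
  define s where "s i = f (min i n)" for i
  have "pstep (v 0) (s i) (s (Suc i))" for i
  proof (cases "i < n")
    case True
    then show ?thesis using f(3) by (simp add: s_def)
  next
    case False
    have "pstep (v 0) (2, w) (2, w)"
      by (rule pstepI[OF special_edge, of 0]) (auto simp: delay_def reset_def)
    then show ?thesis using False f(2) by (simp add: s_def)
  qed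
  then have "\<forall>i. \<exists>d e. step ?M (s i) d e (s (Suc i))"
    unfolding step_iff_pstep by blast
  then obtain d e where "\<And>i. step ?M (s i) (d i) (e i) (s (Suc i))" by metis
  then have "is_run ?M \<infinity> s d e"
    unfolding is_run_def is_config_simulator using f(1) less
    by (auto simp: s_def instantiate_def simulator_def)
  then have "trace_of \<infinity> s e \<in> Traces ?M" unfolding Traces_def by blast
  moreover have "trace_of \<infinity> s e n = Some (2, edge_action (e n))"
    using f(2) by (simp add: trace_of_def s_def)
  then have "trace_of \<infinity> s e \<notin> plain_traces"
    unfolding plain_traces_def by (auto dest: fun_cong[of _ _ n])
  ultimately show ?thesis by blast
qed

text \<open>The guard \<open>positive\<close> fails, and the remaining edges, the cheating ones and
  the loop at \<open>2\<close>, do not enter \<open>2\<close> from another location.\<close>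

lemma not_reachable_0: "\<not> reachable 0 (2, w)"
proof
  have "fst s \<noteq> 2" if "reachable 0 s" for s
    using that unfolding reachable_def
  proof (induction rule: rtranclp_induct)
    case base
    show ?case by simp
  next
    case (step s s')
    from step.hyps(2) obtain d g R where e: "(fst s, g, 0, R, fst s') \<in> E"
      and g: "\<forall>b\<in>set g. psat_atom 0 (delay (snd s) d) b"
      unfolding pstep_def by blast
    have "positive \<notin> set g" using g by (auto simp: positive_def)
    then have "(fst s, g, 0, R, fst s') \<in> base_edges P N"
      using e by (auto simp: simulator_edges_def load_edge_def)
    then show ?case
      using \<open>positive \<notin> set g\<close> step.IH by (cases rule: base_edges_cases) auto
  qed
  then show "reachable 0 (2, w) \<Longrightarrow> False" by fastforce
qed

text \<open>Valuations are extensional and nonnegative, so those other than \<open>v\<close>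
  correspond to the values \<open>q > 0\<close>. Both trace sets are compared with
  \<open>plain_traces\<close>.\<close>

lemma trace_preservation_iff:
  assumes "v \<in> valuations (simulator P N c)" "v 0 = 0"
  shows "trace_preservation (simulator P N c) v \<longleftrightarrow> (\<exists>q>0. \<forall>w. \<not> reachable q (2, w))"
proof -
  have par: "params (simulator P N c) = {0}" by (simp add: simulator_def)
  have v: "Traces (instantiate v (simulator P N c)) = plain_traces"
    using not_reachable_0 assms(2) by (intro Traces_unreachable) simp
  show ?thesis
  proof
    assume "trace_preservation (simulator P N c) v"
    then obtain u where u: "u \<in> valuations (simulator P N c)" "u \<noteq> v"
      "Traces (instantiate u (simulator P N c)) = plain_traces"
      unfolding trace_preservation_def v by blast
    have "u 0 \<noteq> v 0"
      using u(1,2) assms(1) unfolding valuations_def par by (metis PiE_ext singletonD)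
    moreover have "0 \<le> u 0" using u(1) unfolding valuations_def par by auto
    ultimately have "0 < u 0" using assms(2) by simp
    then show "\<exists>q>0. \<forall>w. \<not> reachable q (2, w)" using Traces_reachable u(3) by blast
  next
    assume "\<exists>q>0. \<forall>w. \<not> reachable q (2, w)"
    then obtain q where q: "0 < q" "\<And>w. \<not> reachable q (2, w)" by blast
    let ?u = "v(0 := q)"
    have "?u \<in> valuations (simulator P N c)"
      using assms(1) q(1) unfolding valuations_def par by (auto simp: PiE_iff extensional_def)
    moreover have "?u \<noteq> v" using q(1) assms(2) by (metis fun_upd_same less_irrefl)
    moreover have "Traces (instantiate ?u (simulator P N c)) = plain_traces"
      using q(2) by (intro Traces_unreachable) simp
    ultimately show "trace_preservation (simulator P N c) v"
      unfolding trace_preservation_def v by blast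
  qed
qed

section \<open>The automaton follows the program\<close>

definition shows_content :: "(nat \<Rightarrow> real) \<Rightarrow> (nat \<Rightarrow> nat) \<Rightarrow> bool" where
  "shows_content w s \<longleftrightarrow> w 0 = 0 \<and> (\<forall>j<N. w (Suc j) = real (s j))"

text \<open>The value of clock \<open>0\<close> at which clock \<open>Suc j\<close> is due for its
  reset: it starts the cycle at \<open>s j\<close> and has to reach \<open>p - d\<close> for the
  register being changed, and \<open>p\<close> otherwise.\<close>

definition reset_time :: "real \<Rightarrow> nat \<Rightarrow> (nat \<Rightarrow> nat) \<Rightarrow> nat \<Rightarrow> real" where
  "reset_time p l s j = p - real (s j) -
     (case P ! l of Add r d a \<Rightarrow> if j = r then of_int d else 0 | JZ r a b \<Rightarrow> 0)"

text \<open>Either the clock has not yet been reset in the present cycle, or it was reset exactly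
  when due.\<close>

definition phase :: "real \<Rightarrow> nat \<Rightarrow> (nat \<Rightarrow> nat) \<Rightarrow> (nat \<Rightarrow> real) \<Rightarrow> nat \<Rightarrow> bool" where
  "phase p l s w j \<longleftrightarrow> w (Suc j) = real (s j) + w 0 \<or>
     reset_time p l s j \<le> w 0 \<and> w (Suc j) = w 0 - reset_time p l s j"

lemma instr_edge: "3 \<le> l \<Longrightarrow> l < length P \<Longrightarrow> e \<in> instr_edges N l (P ! l) \<Longrightarrow> e \<in> E"
  unfolding simulator_edges_def base_edges_def by auto

text \<open>\<open>S\<close> contains the registers whose reset is still ahead. Performing the
  resets in the order of their due times ensures that none is missed.\<close>

lemma refresh_steps:
  assumes l: "3 \<le> l" "l < length P" "P ! l = Add r d a" and q: "0 < q"
    and fin: "finite S" "S \<subseteq> {..<N}"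
    and t: "\<And>j. j \<in> S \<Longrightarrow> w (Suc j) = real (s j) + w 0 \<and> w 0 \<le> reset_time (of_rat q) l s j"
      "\<And>j. j < N \<Longrightarrow> j \<notin> S \<Longrightarrow> w (Suc j) = w 0 - reset_time (of_rat q) l s j"
    and le: "\<And>j. j \<in> S \<Longrightarrow> reset_time (of_rat q) l s j \<le> of_rat q" "w 0 \<le> of_rat q"
  shows "\<exists>w'. (pstep q)\<^sup>*\<^sup>* (l, w) (l, w') \<and> w' 0 \<le> of_rat q \<and>
    (\<forall>j<N. w' (Suc j) = w' 0 - reset_time (of_rat q) l s j)"
  using fin t le
proof (induction "card S" arbitrary: S w)
  case 0
  then show ?case by (intro exI[of _ w]) auto
next
  case (Suc n)
  let ?\<tau> = "reset_time (of_rat q) l s"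
  have ne: "S \<noteq> {}" using Suc.hyps(2) by auto
  obtain j where j: "j \<in> S" "\<And>i. i \<in> S \<Longrightarrow> ?\<tau> j \<le> ?\<tau> i"
    using arg_min_if_finite(1)[OF Suc.prems(1) ne, of ?\<tau>] arg_min_least[OF Suc.prems(1) ne, of _ ?\<tau>]
    by blast
  define w' where "w' = reset (delay w (?\<tau> j - w 0)) {Suc j}"
  have w'0: "w' 0 = ?\<tau> j" by (simp add: w'_def reset_def delay_def)
  have "pstep q (l, w) (l, w')"
  proof (rule pstepI)
    show "(l, [positive, ClockParam (Suc j) Eq 0 (if j = r then - d else 0)], 0, {Suc j}, l) \<in> E"
      by (rule instr_edge[OF l(1,2)], unfold l(3) instr_edges.simps, intro insertI2 image_eqI)
        (use j(1) Suc.prems(2) in auto)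
    show "0 \<le> ?\<tau> j - w 0" using Suc.prems(3) j(1) by simp
    show "w' = reset (delay w (?\<tau> j - w 0)) {Suc j}" by (rule w'_def)
    show "psat_atom q (delay w (?\<tau> j - w 0)) b"
      if "b \<in> set [positive, ClockParam (Suc j) Eq 0 (if j = r then - d else 0)]" for b
      using that q Suc.prems(3)[OF j(1)] l(3) by (auto simp: positive_def delay_def reset_time_def)
  qed
  moreover have "\<exists>w''. (pstep q)\<^sup>*\<^sup>* (l, w') (l, w'') \<and> w'' 0 \<le> of_rat q \<and>
      (\<forall>j<N. w'' (Suc j) = w'' 0 - ?\<tau> j)"
  proof (rule Suc.hyps(1))
    show "n = card (S - {j})" using Suc.hyps(2) Suc.prems(1) j(1) by simp
    show "finite (S - {j})" "S - {j} \<subseteq> {..<N}" using Suc.prems(1,2) by auto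
    show "w' (Suc i) = real (s i) + w' 0 \<and> w' 0 \<le> ?\<tau> i" if "i \<in> S - {j}" for i
      using that Suc.prems(3)[of i] j(2) unfolding w'0 by (simp add: w'_def reset_def delay_def)
    show "w' (Suc i) = w' 0 - ?\<tau> i" if "i < N" "i \<notin> S - {j}" for i
      using that Suc.prems(4)[of i] unfolding w'0 by (auto simp: w'_def reset_def delay_def)
    show "?\<tau> i \<le> of_rat q" if "i \<in> S - {j}" for i using that Suc.prems(5) by simp
    show "w' 0 \<le> of_rat q" unfolding w'0 using Suc.prems(5) j(1) by simp
  qed
  ultimately show ?case by (blast intro: converse_rtranclp_into_rtranclp)
qed

text \<open>After all resets, time advances until clock \<open>0\<close> reads \<open>q\<close>,
  when every register clock shows its new content. The distance of the contents from
  \<open>q\<close> leaves room for an increment, so the strict guards hold.\<close>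

lemma cycle_steps:
  assumes l: "3 \<le> l" "l < length P" "P ! l = Add r d a" and q: "0 < q"
    and small: "\<And>j. j < N \<Longrightarrow> real (s j) < of_rat q - 2"
    and nonneg: "0 \<le> int (s r) + d" and w: "shows_content w s"
  shows "\<exists>w'. (pstep q)\<^sup>*\<^sup>* (l, w) (a, w') \<and> shows_content w' (s(r := nat (int (s r) + d)))"
proof -
  let ?\<tau> = "reset_time (of_rat q) l s"
  have r: "r < N" "\<bar>d\<bar> \<le> 1" using instr_ok_nth[of l] l by auto
  have d: "real_of_int d \<le> 1" "0 \<le> real (s r) + real_of_int d"
    using r(2) nonneg by linarith+
  have \<tau>: "0 \<le> ?\<tau> j" "?\<tau> j \<le> of_rat q" if "j < N" for j
    using small[OF that] d l(3) by (auto simp: reset_time_def)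
  obtain w' where w': "(pstep q)\<^sup>*\<^sup>* (l, w) (l, w')" "w' 0 \<le> of_rat q"
    "\<forall>j<N. w' (Suc j) = w' 0 - ?\<tau> j"
    using refresh_steps[OF l q, of "{..<N}" w s] w \<tau> q unfolding shows_content_def by auto
  define w'' where "w'' = reset (delay w' (of_rat q - w' 0)) {0}"
  have val: "delay w' (of_rat q - w' 0) (Suc j) = of_rat q - ?\<tau> j" if "j < N" for j
    using w'(3) that by (simp add: delay_def)
  have "pstep q (l, w') (a, w'')"
  proof (rule pstepI)
    show "(l, positive # ClockParam 0 Eq 0 0 # map (\<lambda>j. ClockParam (Suc j) Lt 0 0) [0..<N],
        0, {0}, a) \<in> E"
      using l by (intro instr_edge) auto
    show "0 \<le> of_rat q - w' 0" using w'(2) by simp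
    show "w'' = reset (delay w' (of_rat q - w' 0)) {0}" by (rule w''_def)
    have "delay w' (of_rat q - w' 0) 0 = of_rat q" by (simp add: delay_def)
    moreover have "delay w' (of_rat q - w' 0) (Suc j) < of_rat q" if "j < N" for j
      using val[OF that] small[OF that] d(1) l(3) by (auto simp: reset_time_def)
    ultimately show "psat_atom q (delay w' (of_rat q - w' 0)) b"
      if "b \<in> set (positive # ClockParam 0 Eq 0 0 # map (\<lambda>j. ClockParam (Suc j) Lt 0 0) [0..<N])" for b
      using that q by (auto simp: positive_def)
  qed
  moreover have "shows_content w'' (s(r := nat (int (s r) + d)))"
    using val l(3) nonneg unfolding shows_content_def
    by (auto simp: w''_def reset_def reset_time_def)
  ultimately show ?thesis using w'(1) by (meson rtranclp.rtrancl_into_rtrancl)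
qed

text \<open>If some content is at least \<open>q - 2\<close>, the overflow edge leads to
  \<open>2\<close> at once; otherwise the cycle has room for the instruction.\<close>

lemma simulation_step:
  assumes "mstep P (l, s) (l', s')" "0 < q" "shows_content w s"
  shows "(\<exists>w'. (pstep q)\<^sup>*\<^sup>* (l, w) (2, w')) \<or>
    (\<exists>w'. (pstep q)\<^sup>*\<^sup>* (l, w) (l', w') \<and> shows_content w' s')"
proof (cases "\<exists>j<N. of_rat q - 2 \<le> real (s j)")
  case True
  then obtain j where j: "j < N" "of_rat q - 2 \<le> real (s j)" by blast
  have l: "3 \<le> l" "l < length P" using assms(1) by (auto elim: mstep.cases)
  have "pstep q (l, w) (2, w)"
  proof (rule pstepI)
    show "(l, [positive, ClockConst 0 Eq 0, ClockParam (Suc j) Ge 0 (- 2)], 0, {}, 2) \<in> E"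
      using l j(1) unfolding simulator_edges_def base_edges_def by auto
    show "psat_atom q (delay w 0) b"
      if "b \<in> set [positive, ClockConst 0 Eq 0, ClockParam (Suc j) Ge 0 (- 2)]" for b
      using that j assms(2,3) by (auto simp: positive_def shows_content_def delay_def)
  qed (auto simp: reset_def delay_def)
  then show ?thesis by blast
next
  case False
  then have small: "real (s j) < of_rat q - 2" if "j < N" for j using that by auto
  show ?thesis using assms(1)
  proof (cases rule: mstep.cases)
    case (add r d)
    then show ?thesis using cycle_steps[OF _ _ _ assms(2) small _ assms(3)] by blast
  next
    case (jz r a b)
    have "r < N" using instr_ok_nth[of l] jz by auto
    then have wr: "w 0 = 0" "w (Suc r) = real (s r)" using assms(3) unfolding shows_content_def by auto
    have "pstep q (l, w) (l', w)"
    proof (cases "s r = 0")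
      case True
      have "(l, [positive, ClockConst 0 Eq 0, ClockConst (Suc r) Eq 0], 0, {}, l') \<in> E"
        using jz True by (intro instr_edge) auto
      then show ?thesis
        by (rule pstepI[of _ _ _ _ 0]) (use True wr assms(2) in \<open>auto simp: positive_def delay_def reset_def\<close>)
    next
      case False
      have "(l, [positive, ClockConst 0 Eq 0, ClockConst (Suc r) Gt 0], 0, {}, l') \<in> E"
        using jz False by (intro instr_edge) auto
      then show ?thesis
        by (rule pstepI[of _ _ _ _ 0]) (use False wr assms(2) in \<open>auto simp: positive_def delay_def reset_def\<close>)
    qed
    then show ?thesis using assms(3) jz by blast
  qed
qed

text \<open>An overflow on the way only reaches the target earlier, so the conclusion holds for
  every positive \<open>q\<close>, however small.\<close>

lemma simulation_steps:
  assumes "(mstep P)\<^sup>*\<^sup>* (l, s) (2, s')" "0 < q" "shows_content w s"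
  shows "\<exists>w'. (pstep q)\<^sup>*\<^sup>* (l, w) (2, w')"
  using assms(1,3)
proof (induction "(l, s)" arbitrary: l s w rule: converse_rtranclp_induct)
  case base
  then show ?case by blast
next
  case (step y)
  obtain m t where y: "y = (m, t)" by (cases y)
  from simulation_step[OF step.hyps(1)[unfolded y] assms(2) step.prems] show ?case
    using step.hyps(3)[OF y] by (meson rtranclp_trans)
qed

definition initial :: "nat \<Rightarrow> nat" where
  "initial = (\<lambda>_. 0)(0 := c)"

lemma reachable_special:
  assumes "(mstep P)\<^sup>*\<^sup>* (3, initial) (2, s)" "0 < q"
  shows "\<exists>w. reachable q (2, w)"
proof -
  define w where "w = reset (delay (\<lambda>_. 0) (real c)) {0 :: nat}"
  define w' where "w' = reset w (Suc ` {1..<N})"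
  have "pstep q (0, \<lambda>_. 0) (1, w)"
  proof (rule pstepI[where d = "real c"])
    show "(0, [positive, ClockConst 1 Eq (int c)], 0, {0}, 1) \<in> E"
      by (simp add: simulator_edges_def load_edge_def)
  qed (use assms(2) in \<open>auto simp: w_def positive_def delay_def\<close>)
  moreover have "pstep q (1, w) (3, w')"
  proof (rule pstepI[where d = 0])
    show "(1, [positive, ClockConst 0 Eq 0], 0, Suc ` {1..<N}, 3) \<in> E"
      by (simp add: simulator_edges_def base_edges_def)
  qed (use assms(2) in \<open>auto simp: w_def w'_def positive_def delay_def reset_def\<close>)
  moreover have "shows_content w' initial"
    unfolding shows_content_def initial_def w'_def w_def
    by (auto simp: reset_def delay_def image_iff)
  then obtain w'' where "(pstep q)\<^sup>*\<^sup>* (3, w') (2, w'')"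
    using simulation_steps[OF assms] by blast
  ultimately show ?thesis
    unfolding reachable_def by (meson converse_rtranclp_into_rtranclp)
qed

section \<open>Without cheating, the automaton does no more than the program\<close>

text \<open>Once clock \<open>0\<close> exceeds \<open>q\<close>, only the loading edge can reset
  it, and that starts a fresh simulation; hence nothing is assumed about clocks in location
  \<open>0\<close>. In location \<open>1\<close> only register \<open>0\<close> matters, since the
  next edge clears the others.\<close>

definition faithful :: "rat \<Rightarrow> nat \<times> (nat \<Rightarrow> real) \<Rightarrow> bool" where
  "faithful q = (\<lambda>(l, w). l \<noteq> 2 \<and>
     (of_rat q < w 0 \<or> l = 0 \<or> l = 1 \<and> w 0 = 0 \<and> w 1 = real c \<or>
      3 \<le> l \<and> (\<exists>s. (mstep P)\<^sup>*\<^sup>* (3, initial) (l, s) \<and> 0 \<le> w 0 \<and> w 0 \<le> of_rat q \<and>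
         (\<forall>j<N. phase (of_rat q) l s w j))))"

lemma faithful_step:
  assumes "faithful q (l, w)" "pstep q (l, w) (l', w')" "0 < q"
    and run: "\<And>m s j. (mstep P)\<^sup>*\<^sup>* (3, initial) (m, s) \<Longrightarrow> 3 \<le> m \<and> (j < N \<longrightarrow> real (s j) < of_rat q - 2)"
  shows "faithful q (l', w')"
proof -
  from assms(2) obtain d g R where d: "0 \<le> d" and e: "(l, g, 0, R, l') \<in> E"
    and g: "\<And>b. b \<in> set g \<Longrightarrow> psat_atom q (delay w d) b" and w': "w' = reset (delay w d) R"
    unfolding pstep_def by auto
  have l2: "l \<noteq> 2" using assms(1) by (simp add: faithful_def)
  have q0: "0 < real_of_rat q" using assms(3) by simp
  have honest: "\<exists>s. (mstep P)\<^sup>*\<^sup>* (3, initial) (l, s) \<and> 0 \<le> w 0 \<and> w 0 \<le> of_rat q \<and>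
      (\<forall>j<N. phase (of_rat q) l s w j)" if "3 \<le> l" "w 0 \<le> of_rat q"
    using assms(1) that unfolding faithful_def by auto
  \<comment> \<open>Tests and overflow need clock \<open>0\<close> to be \<open>0\<close>. No reset
    has then happened in the cycle, because all reset times are positive, so the clocks show the
    contents.\<close>
  have at_zero: "\<exists>s. (mstep P)\<^sup>*\<^sup>* (3, initial) (l, s) \<and> d = 0 \<and> w 0 = 0 \<and>
      (\<forall>j<N. w (Suc j) = real (s j) \<and> real (s j) < of_rat q - 2)"
    if l: "3 \<le> l" "l < length P" and z: "w 0 + d = 0"
  proof -
    have "w 0 \<le> of_rat q" using z d q0 by linarith
    then obtain s where s: "(mstep P)\<^sup>*\<^sup>* (3, initial) (l, s)" "0 \<le> w 0"
      "\<And>j. j < N \<Longrightarrow> phase (of_rat q) l s w j" using honest l(1) by blast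
    have "w 0 = 0" "d = 0" using z d s(2) by linarith+
    moreover have "w (Suc j) = real (s j)" if "j < N" for j
    proof -
      have "instr_ok N (P ! l)" using l(2) by (rule instr_ok_nth)
      then have "0 < reset_time (of_rat q) l s j"
        using run[OF s(1), of j] that by (auto simp: reset_time_def split: instr.split)
      then show ?thesis using s(3)[OF that] \<open>w 0 = 0\<close> unfolding phase_def by auto
    qed
    ultimately show ?thesis using s(1) run by blast
  qed
  have next_instr: "faithful q (m, u)"
    if "(mstep P)\<^sup>*\<^sup>* (3, initial) (m, s)" "u 0 = 0" "\<And>j. j < N \<Longrightarrow> u (Suc j) = real (s j)" for m s u
  proof -
    have "3 \<le> m" using run[OF that(1)] by blast
    moreover have "\<forall>j<N. phase (of_rat q) m s u j" using that(2,3) by (simp add: phase_def)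
    moreover have "0 \<le> u 0" "u 0 \<le> of_rat q" using that(2) q0 by simp_all
    ultimately show ?thesis using that(1) unfolding faithful_def prod.case by fastforce
  qed
  show ?thesis
  proof (cases "(l, g, 0, R, l') = load_edge c")
    case True
    then show ?thesis
      using g[of "ClockConst 1 Eq (int c)"] w' by (auto simp: load_edge_def faithful_def reset_def)
  next
    case False
    then have "(l, g, 0, R, l') \<in> base_edges P N" using e by (simp add: simulator_edges_def)
    then show ?thesis
    proof (cases rule: base_edges_cases)
      case cheat
      then show ?thesis using g w' by (auto simp: faithful_def reset_def)
    next
      case special
      then show ?thesis using l2 by simp
    next
      case start
      then have z: "w 0 + d = 0" using g[of "ClockConst 0 Eq 0"] by (simp add: delay_def)
      then have "\<not> of_rat q < w 0" using d q0 by linarith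
      then have w: "w 0 = 0" "w 1 = real c"
        using assms(1) start(1) unfolding faithful_def by simp_all
      then have d0: "d = 0" using z by simp
      show ?thesis
        unfolding start(2)
      proof (rule next_instr)
        show "(mstep P)\<^sup>*\<^sup>* (3, initial) (3, initial)" by simp
        show "w' 0 = 0" unfolding w' start(4) using w d0 by (auto simp: reset_def delay_def)
        show "w' (Suc j) = real (initial j)" if "j < N" for j
          unfolding w' start(4) using w d0 that
          by (cases "j = 0") (auto simp: reset_def delay_def initial_def image_iff)
      qed
    next
      case (cycle r k b)
      have z: "w 0 + d = of_rat q" using g[of "ClockParam 0 Eq 0 0"] cycle by (simp add: delay_def)
      then have "w 0 \<le> of_rat q" using d by linarith
      then obtain s where s: "(mstep P)\<^sup>*\<^sup>* (3, initial) (l, s)"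
        "\<And>j. j < N \<Longrightarrow> phase (of_rat q) l s w j" "0 \<le> w 0" using honest cycle(1) by blast
      \<comment> \<open>A clock not yet reset would read at least \<open>q\<close>, which the strict
        guard excludes; so each one was reset when due.\<close>
      have val: "w (Suc j) + d = of_rat q - reset_time (of_rat q) l s j" if "j < N" for j
      proof -
        have "w (Suc j) + d < of_rat q"
          using g[of "ClockParam (Suc j) Lt 0 0"] that cycle by (simp add: delay_def)
        then show ?thesis using s(2)[OF that] z unfolding phase_def by auto
      qed
      have r: "r < N" using instr_ok_nth[of l] cycle by auto
      \<comment> \<open>The clock is nonnegative and shows the new content, so an empty register
        cannot have been decremented.\<close>
      have "0 \<le> w (Suc r) + d"
        using s(2)[OF r] s(3) d unfolding phase_def by auto
      then have nonneg: "0 \<le> int (s r) + k"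
        using val[OF r] cycle(3) by (simp add: reset_time_def)
      have "mstep P (l, s) (b, s(r := nat (int (s r) + k)))"
        using cycle nonneg by (intro mstep.add) auto
      then have "(mstep P)\<^sup>*\<^sup>* (3, initial) (b, s(r := nat (int (s r) + k)))"
        using s(1) by (rule rtranclp.rtrancl_into_rtrancl[rotated])
      then show ?thesis
        unfolding cycle(4)
        by (rule next_instr)
          (use val nonneg cycle(3) in \<open>auto simp: w' cycle(5) reset_def delay_def reset_time_def\<close>)
    next
      case (refresh r k b j)
      show ?thesis
      proof (cases "w 0 + d \<le> of_rat q")
        case True
        then have "w 0 \<le> of_rat q" using d by linarith
        then obtain s where s: "(mstep P)\<^sup>*\<^sup>* (3, initial) (l, s)" "0 \<le> w 0"
          "\<And>j. j < N \<Longrightarrow> phase (of_rat q) l s w j" using honest refresh(1) by blast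
        let ?\<tau> = "reset_time (of_rat q) l s"
        have small: "real (s j) < of_rat q - 2" using run[OF s(1)] refresh(4) by blast
        have k: "real_of_int k \<le> 1"
          using instr_ok_nth[of l] refresh by auto
        have "w (Suc j) + d = of_rat q + of_int (if j = r then - k else 0)"
          using g[of "ClockParam (Suc j) Eq 0 (if j = r then - k else 0)"] refresh
          by (simp add: delay_def)
        then have "w (Suc j) + d = ?\<tau> j + real (s j)"
          using refresh(3) by (auto simp: reset_time_def)
        \<comment> \<open>A second reset in the same cycle would need
          \<open>w 0 + d = 2 * ?\<tau> j + real (s j)\<close>. This exceeds \<open>q\<close>,
          because the addend is at most \<open>1\<close> and the content is below
          \<open>q - 2\<close>; here the full margin \<open>2\<close> of the overflow edges is
          used.\<close>
        then have eq: "w 0 + d = ?\<tau> j"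
          using s(3)[OF refresh(4)] True small k refresh(3)
          unfolding phase_def by (auto simp: reset_time_def split: if_splits)
        have "phase (of_rat q) l s w' i" if "i < N" for i
          using s(3)[OF that] eq d unfolding phase_def w' refresh(6)
          by (auto simp: reset_def delay_def)
        then show ?thesis
          using s(1) True d s(2) refresh(1) unfolding faithful_def refresh(5)
          by (auto simp: w' refresh(6) reset_def delay_def)
      next
        case False
        then show ?thesis
          using l2 by (auto simp: faithful_def w' refresh(5,6) reset_def delay_def)
      qed
    next
      case (zero r b b')
      then have "w 0 + d = 0" "w (Suc r) + d = 0"
        using g[of "ClockConst 0 Eq 0"] g[of "ClockConst (Suc r) Eq 0"] by (simp_all add: delay_def)
      moreover have r: "r < N" using instr_ok_nth[of l] zero by auto
      ultimately obtain s where s: "(mstep P)\<^sup>*\<^sup>* (3, initial) (l, s)" "d = 0" "w 0 = 0"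
        "\<And>j. j < N \<Longrightarrow> w (Suc j) = real (s j)" "s r = 0"
        using at_zero[OF zero(1,2)] by force
      have "mstep P (l, s) (if s r = 0 then b else b', s)"
        using zero by (intro mstep.jz)
      then have "(mstep P)\<^sup>*\<^sup>* (3, initial) (b, s)"
        using s(1,5) by (simp add: rtranclp.rtrancl_into_rtrancl)
      then show ?thesis
        unfolding zero(4)
        by (rule next_instr) (use s in \<open>auto simp: w' zero(5) reset_def delay_def\<close>)
    next
      case (nonzero r b b')
      then have "w 0 + d = 0" "0 < w (Suc r) + d"
        using g[of "ClockConst 0 Eq 0"] g[of "ClockConst (Suc r) Gt 0"] by (simp_all add: delay_def)
      moreover have r: "r < N" using instr_ok_nth[of l] nonzero by auto
      ultimately obtain s where s: "(mstep P)\<^sup>*\<^sup>* (3, initial) (l, s)" "d = 0" "w 0 = 0"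
        "\<And>j. j < N \<Longrightarrow> w (Suc j) = real (s j)" "s r \<noteq> 0"
        using at_zero[OF nonzero(1,2)] by force
      have "mstep P (l, s) (if s r = 0 then b else b', s)"
        using nonzero by (intro mstep.jz)
      then have "(mstep P)\<^sup>*\<^sup>* (3, initial) (b', s)"
        using s(1,5) by (simp add: rtranclp.rtrancl_into_rtrancl)
      then show ?thesis
        unfolding nonzero(4)
        by (rule next_instr) (use s in \<open>auto simp: w' nonzero(5) reset_def delay_def\<close>)
    next
      case (overflow j)
      then have "w 0 + d = 0" "of_rat q - 2 \<le> w (Suc j) + d"
        using g[of "ClockConst 0 Eq 0"] g[of "ClockParam (Suc j) Ge 0 (- 2)"]
        by (simp_all add: delay_def)
      then have False using at_zero[OF overflow(1,2)] overflow(3) by force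
      then show ?thesis ..
    qed
  qed
qed

lemma not_reachable_special:
  assumes "\<And>m s j. (mstep P)\<^sup>*\<^sup>* (3, initial) (m, s) \<Longrightarrow> 3 \<le> m \<and> (j < N \<longrightarrow> real (s j) < of_rat q - 2)"
    and "0 < q"
  shows "\<not> reachable q (2, w)"
proof -
  have "faithful q t" if "reachable q t" for t
    using that unfolding reachable_def
  proof (induction rule: rtranclp_induct)
    case base
    show ?case by (simp add: faithful_def)
  next
    case (step t u)
    then show ?case using assms by (cases t; cases u) (blast intro: faithful_step)
  qed
  then show ?thesis by (force simp: faithful_def)
qed

end


subsection \<open>The automaton of a compiled program\<close>

text \<open>For a terminating program this yields a bound on all register contents.\<close>

lemma finite_rtranclp_deterministic:
  assumes "r\<^sup>*\<^sup>* x y" "\<And>a b c. r a b \<Longrightarrow> r a c \<Longrightarrow> b = c" "r y y"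
  shows "finite {z. r\<^sup>*\<^sup>* x z}"
  using assms(1)
proof (induction rule: converse_rtranclp_induct)
  case base
  have "z = y" if "r\<^sup>*\<^sup>* y z" for z
    using that by induction (use assms(2,3) in blast)+
  then have "{z. r\<^sup>*\<^sup>* y z} \<subseteq> {y}" by blast
  then show ?case by (rule finite_subset) simp
next
  case (step a b)
  have "{z. r\<^sup>*\<^sup>* a z} \<subseteq> insert a {z. r\<^sup>*\<^sup>* b z}"
  proof
    fix z assume "z \<in> {z. r\<^sup>*\<^sup>* a z}"
    then have "r\<^sup>*\<^sup>* a z" by simp
    then show "z \<in> insert a {z. r\<^sup>*\<^sup>* b z}"
      by (cases rule: converse_rtranclpE) (use assms(2)[OF step.hyps(1)] in blast)+
  qed
  then show ?case using step.IH by (meson finite_insert finite_subset)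
qed

text \<open>The path is unique, so the loop lies ahead of every visited configuration. Hence each of
  them can make a step, which excludes address \<open>2\<close>.\<close>

lemma rtranclp_deterministic_loop:
  assumes "r\<^sup>*\<^sup>* x y" "r\<^sup>*\<^sup>* x z" "\<And>a b c. r a b \<Longrightarrow> r a c \<Longrightarrow> b = c" "r y y"
  shows "r\<^sup>*\<^sup>* z y"
  using assms(1,2)
proof (induction rule: converse_rtranclp_induct)
  case base
  then have "z = y" by induction (use assms(3,4) in blast)+
  then show ?case by simp
next
  case (step a b)
  from step.prems show ?case
  proof (cases rule: converse_rtranclpE)
    case base
    then show ?thesis using step.hyps by auto
  next
    case (step b')
    then show ?thesis using assms(3) step.IH \<open>r a b\<close> by blast
  qed
qed

text \<open>
  The first three instructions are placeholders: the automaton loads the input in the locations \<open>0\<close>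
  and \<open>1\<close>, and \<open>2\<close> is its special location.
\<close>

definition program :: "recf \<Rightarrow> instr list" where
  "program f = (let p = code (compile f [0] 1 2) 3 in
     replicate 3 (JZ 0 0 0) @ p @ [JZ 1 (3 + length p) 2])"

lemma program_run:
  assumes "reval f [c] y"
  shows "(mstep (program f))\<^sup>*\<^sup>* (3, (\<lambda>_. 0)(0 := c))
    (length (program f) - 1, (\<lambda>_. 0)(0 := c, 1 := y))"
proof -
  let ?s = "(\<lambda>_. 0)(0 := c)"
  have "exec (compile f [0] 1 2) ?s (?s(1 := y))"
    using compile_correct assms by (rule compiledD) auto
  from code_correct[OF this, of "program f" "replicate 3 (JZ 0 0 0)"] show ?thesis
    by (simp add: program_def Let_def del: replicate.simps)
qed

text \<open>Looping on output \<open>0\<close> turns termination into a fixed point, which keeps the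
  set of visited configurations finite.\<close>

lemma program_final:
  defines "l \<equiv> \<lambda>f. length (program f) - 1"
  shows "s 1 = 0 \<Longrightarrow> mstep (program f) (l f, s) (l f, s)"
    "s 1 \<noteq> 0 \<Longrightarrow> mstep (program f) (l f, s) (2, s)"
proof -
  have *: "3 \<le> l f" "l f < length (program f)" "program f ! l f = JZ 1 (l f) 2"
    by (auto simp: l_def program_def Let_def nth_append)
  show "s 1 = 0 \<Longrightarrow> mstep (program f) (l f, s) (l f, s)"
    "s 1 \<noteq> 0 \<Longrightarrow> mstep (program f) (l f, s) (2, s)"
    using mstep.jz[OF *, of s] by auto
qed

lemma Add_in_program: "Add r d a \<in> set (program f) \<Longrightarrow> \<bar>d\<bar> \<le> 1"
  by (auto simp: program_def Let_def dest: Add_in_code)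

fun instr_bound :: "instr \<Rightarrow> nat" where
  "instr_bound (Add r d a) = Suc (r + a)"
| "instr_bound (JZ r a b) = Suc (r + a + b)"

text \<open>Summing over all instructions is a crude way to exceed every register and address that
  occurs.\<close>

definition program_bound :: "recf \<Rightarrow> nat" where
  "program_bound f = 4 + length (program f) + sum_list (map instr_bound (program f))"

lemma simulation_program:
  assumes "program_bound f < c"
  shows "simulation (program f) (program_bound f) c"
proof
  show "instr_ok (program_bound f) i" if "i \<in> set (program f)" for i
  proof -
    have "instr_bound i < program_bound f"
      using member_le_sum_list[of "instr_bound i" "map instr_bound (program f)"] that
      by (simp add: program_bound_def)
    then show ?thesis using that Add_in_program[of _ _ _ f] by (cases i) auto
  qed
qed (use assms in \<open>auto simp: program_bound_def\<close>)

definition zero_valuation :: "nat \<Rightarrow> rat" where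
  "zero_valuation = (\<lambda>p. if p = 0 then 0 else undefined)"

lemma trace_preservation_simulator:
  assumes "program_bound f < c" "reval f [c] y"
  shows "trace_preservation (simulator (program f) (program_bound f) c) zero_valuation \<longleftrightarrow> y = 0"
proof -
  interpret simulation "program f" "program_bound f" c
    using assms(1) by (rule simulation_program)
  let ?m = "mstep (program f)"
  let ?y = "(length (program f) - 1, initial(1 := y))"
  have run: "?m\<^sup>*\<^sup>* (3, initial) ?y"
    using program_run[OF assms(2)] by (simp add: initial_def)
  have "zero_valuation \<in> valuations (simulator (program f) (program_bound f) c)"
    by (auto simp: zero_valuation_def valuations_def simulator_def PiE_iff extensional_def)
  then have iff: "trace_preservation (simulator (program f) (program_bound f) c) zero_valuation \<longleftrightarrow>
      (\<exists>q>0. \<forall>w. \<not> reachable q (2, w))"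
    by (rule trace_preservation_iff) (simp add: zero_valuation_def)
  show ?thesis
  proof (cases "y = 0")
    case True
    then have loop: "?m ?y ?y" using program_final(1) by simp
    \<comment> \<open>The largest register content in the whole run. The parameter value
      \<open>B + 3\<close> then keeps all contents below \<open>q - 2 = B + 1\<close>.\<close>
    define B where "B = Max ((\<lambda>((l, s), j). s j) ` ({z. ?m\<^sup>*\<^sup>* (3, initial) z} \<times> {..<program_bound f}))"
    have fin: "finite {z. ?m\<^sup>*\<^sup>* (3, initial) z}"
      using run mstep_deterministic loop by (rule finite_rtranclp_deterministic)
    have "3 \<le> m \<and> (j < program_bound f \<longrightarrow> real (s j) < of_rat (of_nat (B + 3)) - 2)"
      if ms: "?m\<^sup>*\<^sup>* (3, initial) (m, s)" for m s j
    proof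
      have "?m\<^sup>*\<^sup>* (m, s) ?y"
        using run ms mstep_deterministic loop by (rule rtranclp_deterministic_loop)
      then show "3 \<le> m"
      proof (cases rule: converse_rtranclpE)
        case base
        then show ?thesis using loop by (auto elim: mstep.cases)
      next
        case (step z)
        then show ?thesis by (auto elim: mstep.cases)
      qed
      have "s j \<le> B" if "j < program_bound f"
        unfolding B_def by (rule Max_ge) (use fin that ms in \<open>auto intro!: image_eqI[of _ _ "((m, s), j)"]\<close>)
      then show "j < program_bound f \<longrightarrow> real (s j) < of_rat (of_nat (B + 3)) - 2"
        by (auto simp: of_rat_add)
    qed
    then have "\<not> reachable (of_nat (B + 3)) (2, w)" for w
      by (rule not_reachable_special) simp_all
    moreover have "(0 :: rat) < of_nat (B + 3)" by simp
    ultimately show ?thesis using True iff by blast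
  next
    case False
    have "?m\<^sup>*\<^sup>* (3, initial) (2, initial(1 := y))"
      by (rule rtranclp.rtrancl_into_rtrancl[OF run]) (rule program_final(2), use False in simp)
    then show ?thesis using False iff reachable_special by blast
  qed
qed


subsection \<open>Codes of the automata\<close>

text \<open>The numbers \<open>1\<close>, \<open>1\<close> and \<open>2\<close> are the tag of
  \<open>ClockConst\<close>, the clock and the code of \<open>Eq\<close>; \<open>2 * c\<close> is
  the integer code of \<open>c\<close>. In this form computability is evident.\<close>

definition load_code :: "nat \<Rightarrow> nat" where
  "load_code c = list_encode [0,
     list_encode [patom_code positive, prod_encode (1, prod_encode (1, prod_encode (2, 2 * c)))],
     0, set_encode {0}, 1]"

lemma edge_code_load_edge: "edge_code (load_edge c) = load_code c"
  by (simp add: edge_code_def load_edge_def load_code_def constraint_code_def int_encode_def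
      sum_encode_def)

text \<open>Finite sets are coded as sums of powers of two. The edges have code
  \<open>c + 2 ^ load_code c\<close> when \<open>c\<close> is itself the code of the base edges; the
  \<open>0\<close> in \<open>prod_encode (i, 0)\<close> codes an empty invariant.\<close>

definition self_code :: "nat \<Rightarrow> nat" where
  "self_code c = prod_encode (list_encode
     [set_encode {0}, \<Sum>i<c. 2 ^ i, 0, \<Sum>i<c. 2 ^ i, set_encode {0}, \<Sum>i<c. 2 ^ prod_encode (i, 0),
      c + 2 ^ load_code c], valuation_code {0} zero_valuation)"

lemma computable_list_encode_Cons:
  assumes "computable k h" "computable k (\<lambda>xs. list_encode (t xs))"
  shows "computable k (\<lambda>xs. list_encode (h xs # t xs))"
  unfolding list_encode.simps by (intro computable_Suc computable_prod_encode assms)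

lemma computable_self_code: "computable 1 (\<lambda>xs. self_code (xs ! 0))"
proof -
  have id: "computable 1 (\<lambda>xs. xs ! 0)" by (rule computable_nth) simp
  have "computable 1 (\<lambda>xs. load_code (xs ! 0))"
    unfolding load_code_def mult_2
    by (intro computable_list_encode_Cons computable_prod_encode computable_add id computable_const)
  then have "computable 1 (\<lambda>xs. xs ! 0 + 2 ^ load_code (xs ! 0))"
    by (intro computable_add computable_power2 id)
  moreover have "computable 1 (\<lambda>xs. \<Sum>i<xs ! 0. 2 ^ i)"
    "computable 1 (\<lambda>xs. \<Sum>i<xs ! 0. 2 ^ prod_encode (i, 0))"
    by (intro computable_sum[OF _ id] computable_power2 computable_prod_encode id computable_const)+
  ultimately show ?thesis
    unfolding self_code_def
    by (intro computable_list_encode_Cons computable_prod_encode computable_const)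
qed

lemma finite_base_edge_reset: "(l, g, a, R, l') \<in> base_edges P N \<Longrightarrow> finite R"
  by (elim base_edges_cases) auto

lemma inj_on_edge_code: "inj_on edge_code (insert (load_edge c) (base_edges P N))"
  by (rule edge_code_inj_on) (auto simp: load_edge_def dest: finite_base_edge_reset)

lemma load_edge_not_base: "load_edge c \<notin> base_edges P N"
proof
  assume "load_edge c \<in> base_edges P N"
  then show False
    unfolding load_edge_def by (cases rule: base_edges_cases) (auto simp: positive_def)
qed

text \<open>A new element adds its power of two to the code of a set; that it is new needs
  \<open>load_edge_not_base\<close> and the injectivity of \<open>edge_code\<close>.\<close>

lemma edges_code:
  "set_encode (edge_code ` simulator_edges P N c) = set_encode (edge_code ` base_edges P N) + 2 ^ load_code c"
proof -
  have "edge_code (load_edge c) \<notin> edge_code ` base_edges P N"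
    using inj_on_edge_code[of c P N] load_edge_not_base[of c P N] by (auto simp: inj_on_insert)
  then show ?thesis
    by (simp add: simulator_edges_def set_encode_def finite_base_edges edge_code_load_edge)
qed

lemma instance_code_simulator:
  assumes "c = set_encode (edge_code ` base_edges P N)"
  shows "instance_code (simulator P N c, zero_valuation) = self_code c"
proof -
  have "set_encode ((\<lambda>l. prod_encode (l, 0)) ` {..<c}) = (\<Sum>i<c. 2 ^ prod_encode (i, 0))"
    unfolding set_encode_def by (subst sum.reindex) (auto simp: inj_on_def)
  moreover have "set_encode {..<c} = (\<Sum>i<c. 2 ^ i)" by (simp add: set_encode_def)
  ultimately show ?thesis
    using edges_code[of P N c]
    by (simp add: instance_code_def pta_code_def simulator_def self_code_def constraint_code_def
        flip: assms)
qed

lemma less_code_base_edges: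
  assumes "4 \<le> N"
  shows "N < set_encode (edge_code ` base_edges P N)"
proof -
  \<comment> \<open>The cheating loop at \<open>N - 1\<close>, which differs from \<open>2\<close>
    as \<open>4 \<le> N\<close>. Its code exceeds its source, and the code of a set exceeds its
    elements.\<close>
  let ?e = "(N - 1, [ClockParam 0 Gt 0 0], 0, {}, N - 1) :: pedge"
  have e: "?e \<in> base_edges P N" using assms by (auto simp: base_edges_def)
  have "Suc (N - 1) \<le> edge_code ?e"
    unfolding edge_code_def prod.case list_encode.simps Suc_le_mono by (rule le_prod_encode_1)
  then have "N \<le> edge_code ?e" using assms by simp
  also have "\<dots> < 2 ^ edge_code ?e" by (rule less_exp)
  also have "\<dots> \<le> set_encode (edge_code ` base_edges P N)"
    unfolding set_encode_def using e finite_base_edges by (intro member_le_sum) auto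
  finally show ?thesis .
qed

theorem theorem3p6:
  shows "\<not> decidable_problem instance_code one_parameter_instances
           (\<lambda>(A, v). trace_preservation A v)"
proof
  assume "decidable_problem instance_code one_parameter_instances
           (\<lambda>(A, v). trace_preservation A v)"
  then obtain f where f: "\<And>A v. (A, v) \<in> one_parameter_instances \<Longrightarrow>
      reval f [instance_code (A, v)] (if trace_preservation A v then 1 else 0)"
    unfolding decidable_problem_def by fastforce
  obtain g where g: "\<And>c. reval g [c] (self_code c)"
    using computable_self_code unfolding computable_def by (metis length_Cons list.size(3) nth_Cons_0 One_nat_def)
  define P where "P = program (Comp f [g])"
  define N where "N = program_bound (Comp f [g])"
  \<comment> \<open>The choice is not circular: \<open>P\<close> and \<open>N\<close>, and with them
    the base edges, do not depend on \<open>c\<close>.\<close>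
  define c where "c = set_encode (edge_code ` base_edges P N)"
  let ?A = "simulator P N c"
  have "N < c"
    unfolding c_def by (rule less_code_base_edges) (simp add: N_def program_bound_def)
  then interpret simulation P N c
    unfolding P_def N_def by (rule simulation_program)
  have "(?A, zero_valuation) \<in> one_parameter_instances"
    using is_pta_simulator
    by (auto simp: one_parameter_instances_def valuations_def simulator_def zero_valuation_def
        PiE_iff extensional_def)
  moreover have "instance_code (?A, zero_valuation) = self_code c"
    using c_def by (rule instance_code_simulator)
  ultimately have "reval f [self_code c] (if trace_preservation ?A zero_valuation then 1 else 0)"
    using f by metis
  then have "reval (Comp f [g]) [c] (if trace_preservation ?A zero_valuation then 1 else 0)"
    by (rule reval_Comp1[OF g])
  \<comment> \<open>On input \<open>c\<close> the program outputs the verdict of \<open>f\<close> on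
    its own automaton, but trace preservation holds exactly if this output is
    \<open>0\<close>.\<close>
  then have "trace_preservation ?A zero_valuation \<longleftrightarrow>
      (if trace_preservation ?A zero_valuation then 1 else 0) = (0 :: nat)"
    unfolding P_def N_def using \<open>N < c\<close>[unfolded N_def] by (intro trace_preservation_simulator)
  then show False by (simp split: if_splits)
qed

end
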